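(* Let $Q>0$, let $\gamma_+$ be the larger root of $\gamma-\log\gamma=Q+1$, and let $\Omega_Q=\{(x,y): x\log x\le y\le x\log x+Qx\}$. For $(x,y)\in\Omega_Q$ define $$\mathcal B(x,y)=\sup\{\langle w^{1+\varepsilon}\rangle_{[0,1]}:\ \langle w\rangle_{[0,1]}=x,\ \langle w\log w\rangle_{[0,1]}=y,\ [w]_{RH_1,[0,1]}\le Q\}.$$ Assume $0<\varepsilon<\frac{1}{\gamma_+-1}$. Then $$\mathcal B(x,y)=\frac{v(x,y)^{\varepsilon}}{1+\varepsilon-\gamma_+\varepsilon}\big(x(1+\varepsilon)-\varepsilon\gamma_+ v(x,y)\big),$$ where $v=v(x,y)$ is determined implicitly by $y=(\log v+\gamma_+)x-v\gamma_+$ together with $v\le x\le\gamma_+v$. Moreover, if $y=x\log x+Qx$ then the supremum is attained on $w_{ex}(t)=\frac{x}{\gamma_+}t^{\frac{1-\gamma_+}{\gamma_+}}$, while for arbitrary $(x,y)\in\Omega_Q$ the supremum is attained on a function of the form $$w_{ex}(t)=\begin{cases}Ct^{\frac{1-\gamma_+}{\gamma_+}},& t\in(0,a],\\ Ca^{\frac{1-\gamma_+}{\gamma_+}},& t\in[a,1]\end{cases}$$ for some constants $C>0$, $a\in[0,1]$.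
   Context: $\langle f\rangle_J=\frac1{|J|}\int_J f$. For a weight $w$ (a.e. positive, integrable) on $[0,1]$, $[w]_{RH_1,[0,1]}=\sup_{J\subset[0,1]}\Big\langle \frac{w}{\langle w\rangle_J}\log\frac{w}{\langle w\rangle_J}\Big\rangle_J$, supremum over subintervals $J$.
   Formalization: For a=0 the displayed extremal formula is undefined (0 to a negative power), yet at y = x log x only constant weights qualify; a=0 is therefore read as the constant weight w = C. Points of Ω_Q are taken with x>0. *)

theory Defs
  imports "HOL-Analysis.Analysis"
begin

definition avg :: "real \<Rightarrow> real \<Rightarrow> (real \<Rightarrow> real) \<Rightarrow> real" where
  "avg a b f = (LINT t:{a..b}|lborel. f t) / (b - a)"

definition weight01 :: "(real \<Rightarrow> real) \<Rightarrow> bool" where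
  "weight01 w \<longleftrightarrow> set_integrable lborel {0..1} w \<and>
     (AE t in lborel. t \<in> {0..1} \<longrightarrow> 0 < w t)"

definition rh1 :: "(real \<Rightarrow> real) \<Rightarrow> ereal" where
  "rh1 w = Sup {ereal (avg a b (\<lambda>t. (w t / avg a b w) * ln (w t / avg a b w))) | a b.
                 0 \<le> a \<and> a < b \<and> b \<le> 1}"

text \<open>Admissible weights for the Bellman function at the point (x,y).
  The condition \<langle>w log w\<rangle> = y presupposes that w log w is integrable on [0,1].\<close>
definition admissible :: "real \<Rightarrow> real \<Rightarrow> real \<Rightarrow> (real \<Rightarrow> real) \<Rightarrow> bool" where
  "admissible Q x y w \<longleftrightarrow> weight01 w \<and>
     set_integrable lborel {0..1} (\<lambda>t. w t * ln (w t)) \<and>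
     avg 0 1 w = x \<and> avg 0 1 (\<lambda>t. w t * ln (w t)) = y \<and> rh1 w \<le> ereal Q"

definition pow_avg :: "real \<Rightarrow> (real \<Rightarrow> real) \<Rightarrow> ereal" where
  "pow_avg \<epsilon> w = enn2ereal (\<integral>\<^sup>+ t\<in>{0..1}. ennreal (w t powr (1 + \<epsilon>)) \<partial>lborel)"

definition Bell :: "real \<Rightarrow> real \<Rightarrow> real \<Rightarrow> real \<Rightarrow> ereal" where
  "Bell \<epsilon> Q x y = Sup (pow_avg \<epsilon> ` {w. admissible Q x y w})"

end

theory Submission
  imports Defs
begin

text \<open>
  For \<open>L > 0\<close> put \<open>G(s, L) = s ln s - s ln L - (1 + Q) s + L\<close>. The \<open>RH\<^sub>1\<close> condition says that
  \<open>G(w, L)\<close> has nonpositive integral over every interval on which \<open>w\<close> has mean \<open>L\<close>. If \<open>L \<ge> x\<close>, the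
  rising sun lemma gives disjoint intervals of mean \<open>L\<close> with \<open>w \<le> L\<close> a.e. outside. Since
  \<open>G(s, L) \<le> 0\<close> for \<open>s \<le> L \<le> \<gamma> s\<close> and \<open>G(s, L) \<ge> 0\<close> for \<open>L \<ge> \<gamma> s\<close>, it follows that
  \<open>G(w, L)\<close> has nonpositive integral over \<open>{\<gamma> w \<ge> L}\<close>. Integrating this against
  \<open>L\<^sup>\<epsilon>\<^sup>-\<^sup>1 dL\<close> over \<open>L \<ge> \<gamma> v\<close> yields the upper bound for the average of \<open>w\<^sup>1\<^sup>+\<^sup>\<epsilon>\<close>: the
  contribution of the lower end point \<open>\<gamma> v\<close> is affine in \<open>w\<close> and \<open>w ln w\<close>. All inequalities
  are equalities for a truncated power with plateau value \<open>v\<close>, and \<open>G\<close> also shows that this weight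
  satisfies the \<open>RH\<^sub>1\<close> condition.
\<close>

section \<open>The rising sun lemma\<close>

text \<open>A component is open, connected and bounded, so it is the interval between its infimum
  and supremum. An end point in \<open>U\<close> could be added to it without losing connectedness,
  against maximality.\<close>

lemma component_open_bounded_real:
  fixes U :: "real set"
  assumes "open U" "bounded U" "S \<in> components U"
  obtains p q where "p < q" "S = {p<..<q}" "p \<notin> U" "q \<notin> U"
proof -
  have SU: "S \<subseteq> U" and ne: "S \<noteq> {}" and conn: "connected S" and op: "open S"
    using assms in_components_subset in_components_nonempty in_components_connected open_components
    by blast+
  have bdd: "bounded S" using SU assms(2) bounded_subset by blast
  then have ba: "bdd_above S" "bdd_below S"
    by (auto simp: bounded_imp_bdd_above bounded_imp_bdd_below)
  define p q where "p = Inf S" and "q = Sup S"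
  have pS: "p \<notin> S"
  proof
    assume "p \<in> S"
    then obtain e where "e > 0" "ball p e \<subseteq> S" using op open_contains_ball by blast
    then have "p - e/2 \<in> S" by (auto simp: dist_real_def subset_eq)
    then have "p \<le> p - e/2" unfolding p_def using ba by (intro cInf_lower)
    with \<open>e > 0\<close> show False by simp
  qed
  have qS: "q \<notin> S"
  proof
    assume "q \<in> S"
    then obtain e where "e > 0" "ball q e \<subseteq> S" using op open_contains_ball by blast
    then have "q + e/2 \<in> S" by (auto simp: dist_real_def subset_eq)
    then have "q + e/2 \<le> q" unfolding q_def using ba by (intro cSup_upper)
    with \<open>e > 0\<close> show False by simp
  qed
  have S_eq: "S = {p<..<q}"
  proof (intro set_eqI iffI)
    fix x assume x: "x \<in> S"
    then have "p \<le> x" "x \<le> q" unfolding p_def q_def using ba by (auto intro: cInf_lower cSup_upper)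
    with pS qS x show "x \<in> {p<..<q}" by (auto simp: less_le)
  next
    fix x assume "x \<in> {p<..<q}"
    then obtain y z where "y \<in> S" "y < x" "z \<in> S" "x < z"
      unfolding p_def q_def using cInf_lessD[OF ne] less_cSup_iff[OF ne ba(1)]
      by (metis greaterThanLessThan_iff)
    then show "x \<in> S" using conn
      by (meson connected_contains_Icc subsetD atLeastAtMost_iff less_imp_le)
  qed
  with ne have pq: "p < q" by auto
  then obtain r where r: "p < r" "r < q" using dense by blast
  have "p \<notin> U"
  proof
    assume "p \<in> U"
    then have "{p..<q} \<subseteq> U" using SU S_eq by (auto simp: less_le)
    moreover have "r \<in> S \<inter> {p..<q}" using S_eq r by simp
    ultimately have "{p..<q} \<subseteq> S"
      by (intro components_maximal[OF assms(3)] convex_connected) auto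
    with pS pq show False by auto
  qed
  moreover have "q \<notin> U"
  proof
    assume "q \<in> U"
    then have "{p<..q} \<subseteq> U" using SU S_eq by (auto simp: less_le)
    moreover have "r \<in> S \<inter> {p<..q}" using S_eq r by simp
    ultimately have "{p<..q} \<subseteq> S"
      by (intro components_maximal[OF assms(3)] convex_connected) auto
    with qS pq show False by auto
  qed
  ultimately show ?thesis using that pq S_eq by blast
qed

text \<open>The components of \<open>U\<close> are countably many disjoint open intervals with end
  points off \<open>U\<close>. Finite unions of them have nonpositive integral, and these unions
  increase to \<open>U\<close>.\<close>

lemma set_integral_open_nonpos:
  fixes f :: "real \<Rightarrow> real"
  assumes "open U" "bounded U" "set_integrable lborel U f"
    and comp: "\<And>p q. p < q \<Longrightarrow> {p<..<q} \<subseteq> U \<Longrightarrow> p \<notin> U \<Longrightarrow> q \<notin> U \<Longrightarrow>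
                 (LINT t:{p<..<q}|lborel. f t) \<le> 0"
  shows "(LINT t:U|lborel. f t) \<le> 0"
proof -
  let ?C = "components U"
  have opC: "open S" if "S \<in> ?C" for S using that assms(1) open_components by blast
  have "countable ?C"
    using opC pairwise_disjoint_components[of U]
    by (intro countable_disjoint_open_subsets) (simp_all add: pairwise_def disjnt_def)
  \<comment> \<open>The enumeration of the components is padded with empty sets, so that finitely
    and infinitely many components are treated alike.\<close>
  define D where "D i = (if i \<in> to_nat_on ?C ` ?C then from_nat_into ?C i else {})" for i
  have D_cases: "D i = {} \<or> D i \<in> ?C" for i
    unfolding D_def by (auto intro: from_nat_into)
  have UD: "(\<Union>i. D i) = U"
  proof
    show "(\<Union>i. D i) \<subseteq> U" using D_cases in_components_subset by fastforce
    show "U \<subseteq> (\<Union>i. D i)"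
    proof
      fix x assume "x \<in> U"
      then obtain S where S: "S \<in> ?C" "x \<in> S" using Union_components by blast
      then have "D (to_nat_on ?C S) = S" using \<open>countable ?C\<close> by (auto simp: D_def)
      with S show "x \<in> (\<Union>i. D i)" by blast
    qed
  qed
  have disj: "D i \<inter> D j = {}" if "i \<noteq> j" for i j
  proof (rule ccontr)
    assume ne: "D i \<inter> D j \<noteq> {}"
    then have "i \<in> to_nat_on ?C ` ?C" "j \<in> to_nat_on ?C ` ?C" by (auto simp: D_def split: if_splits)
    moreover have "D i = D j" using ne D_cases components_nonoverlap by blast
    ultimately show False using that \<open>countable ?C\<close> by (auto simp: D_def)
  qed
  have Dop: "open (D i)" for i using D_cases[of i] opC by auto
  have D_le: "(LINT t:D i|lborel. f t) \<le> 0" for i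
  proof (cases "D i = {}")
    case False
    with D_cases obtain p q where "p < q" "D i = {p<..<q}" "p \<notin> U" "q \<notin> U"
      using component_open_bounded_real[OF assms(1,2)] by metis
    with comp[of p q] UD show ?thesis by auto
  qed (simp add: set_lebesgue_integral_def)
  let ?E = "\<lambda>n. \<Union>i<n. D i"
  have UE: "(\<Union>n. ?E n) = U" using UD by blast
  have "set_integrable lborel (D i) f" for i
    using Dop[of i] UD by (intro set_integrable_subset[OF assms(3)]) auto
  then have "(LINT t:?E n|lborel. f t) = (\<Sum>i<n. LINT t:D i|lborel. f t)" for n
    using Dop disj by (intro set_integral_finite_Union) (auto simp: disjoint_family_on_def)
  then have "(LINT t:?E n|lborel. f t) \<le> 0" for n
    by (simp add: sum_nonpos D_le)
  moreover have "(\<lambda>n. LINT t:?E n|lborel. f t) \<longlonglongrightarrow> (LINT t:(\<Union>n. ?E n)|lborel. f t)"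
  proof (rule set_integral_cont_up)
    show "?E n \<in> sets lborel" for n using Dop by (auto intro!: borel_open)
    show "incseq ?E" by (auto simp: incseq_def intro: less_le_trans)
    show "set_integrable lborel (\<Union>n. ?E n) f" unfolding UE by (rule assms(3))
  qed
  ultimately show ?thesis unfolding UE by (intro LIMSEQ_le_const2) auto
qed

text \<open>The hypothesis passes from intervals to open sets by splitting into components, and from
  open sets to \<open>{f > 0}\<close> by outer regularity of the measure with density
  \<open>\<bar>f\<bar>\<close>. A positive function whose integral is nonpositive lives on a null
  set.\<close>

lemma AE_nonpos_if_interval_integrals_nonpos:
  fixes f :: "real \<Rightarrow> real"
  assumes f: "set_integrable lborel {c..d} f"
    and int: "\<And>p q. c \<le> p \<Longrightarrow> p < q \<Longrightarrow> q \<le> d \<Longrightarrow> (LINT t:{p<..<q}|lborel. f t) \<le> 0"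
  shows "AE t in lborel. t \<in> {c..d} \<longrightarrow> f t \<le> 0"
proof -
  \<comment> \<open>Cutting off to the open interval keeps intersections with open sets open; the
    two end points are restored at the end as null sets.\<close>
  define g where "g t = indicator {c<..<d} t * f t" for t
  have "set_integrable lborel {c<..<d} f" by (rule set_integrable_subset[OF f]) auto
  then have g: "integrable lborel g" unfolding g_def set_integrable_def by simp
  then have gm [measurable]: "g \<in> borel_measurable borel" by (auto dest: borel_measurable_integrable)
  let ?A = "{t. 0 < g t}"
  have A: "?A \<in> sets borel" by measurable
  have gB: "integrable lborel (\<lambda>t. indicator B t * g t)" if "B \<in> sets borel" for B
    using integrable_mult_indicator[of B lborel g] g that by simp
  have gB': "integrable lborel (\<lambda>t. indicator B t * \<bar>g t\<bar>)" if "B \<in> sets borel" for B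
    using integrable_mult_indicator[of B lborel "\<lambda>t. \<bar>g t\<bar>"] g that by simp
  let ?M = "density lborel (\<lambda>t. ennreal \<bar>g t\<bar>)"
  define \<mu> where "\<mu> B = (LINT t|lborel. indicator B t * \<bar>g t\<bar>)" for B :: "real set"
  define \<nu> where "\<nu> B = (LINT t|lborel. indicator B t * g t)" for B :: "real set"
  have em: "emeasure ?M B = ennreal (\<mu> B)" if [measurable]: "B \<in> sets borel" for B
  proof -
    have "emeasure ?M B = (\<integral>\<^sup>+ t. ennreal (indicator B t * \<bar>g t\<bar>) \<partial>lborel)"
      by (subst emeasure_density) (auto intro!: nn_integral_cong simp: ennreal_mult' split: split_indicator)
    also have "\<dots> = ennreal (\<mu> B)"
      unfolding \<mu>_def using gB'[OF that] by (intro nn_integral_eq_integral) auto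
    finally show ?thesis .
  qed
  have \<mu>_nonneg: "0 \<le> \<mu> B" for B unfolding \<mu>_def by (intro integral_nonneg_AE) auto
  have open_int: "\<nu> U \<le> 0" if "open U" for U
  proof -
    have "\<nu> U = (LINT t:(U \<inter> {c<..<d})|lborel. f t)"
      unfolding set_lebesgue_integral_def g_def \<nu>_def
      by (auto intro!: Bochner_Integration.integral_cong split: split_indicator)
    also have "\<dots> \<le> 0"
    proof (rule set_integral_open_nonpos)
      show "open (U \<inter> {c<..<d})" using that by auto
      show "set_integrable lborel (U \<inter> {c<..<d}) f" using that by (intro set_integrable_subset[OF f]) auto
      show "bounded (U \<inter> {c<..<d})" using bounded_Int bounded_box[of c d] by auto
      fix p q :: real assume "p < q" "{p<..<q} \<subseteq> U \<inter> {c<..<d}"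
      then show "(LINT t:{p<..<q}|lborel. f t) \<le> 0"
        using greaterThanLessThan_subseteq_greaterThanLessThan[of p q c d] by (intro int) auto
    qed
    finally show ?thesis .
  qed
  have A0: "\<nu> ?A \<le> 0"
  proof (rule ccontr)
    assume "\<not> ?thesis"
    then have pos: "0 < \<nu> ?A" by simp
    have fin: "emeasure ?M (space ?M) \<noteq> \<infinity>" using em[of UNIV] by simp
    have "emeasure ?M ?A = (INF U\<in>{U. ?A \<subseteq> U \<and> open U}. emeasure ?M U)"
      using A fin by (intro outer_regular) auto
    \<comment> \<open>The slack \<open>\<nu> ?A\<close> is chosen so that the excess
      \<open>U - ?A\<close> has \<open>\<mu>\<close>-measure below \<open>\<nu> ?A\<close>. It then
      cannot cancel the positive integral over \<open>?A\<close>, and \<open>\<nu> U > 0\<close>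
      contradicts \<open>open_int\<close>.\<close>
    moreover have "emeasure ?M ?A < ennreal (\<mu> ?A + \<nu> ?A)"
      using pos em[OF A] \<mu>_nonneg[of ?A] by (simp add: ennreal_lessI)
    ultimately have "\<exists>U\<in>{U. ?A \<subseteq> U \<and> open U}. emeasure ?M U < ennreal (\<mu> ?A + \<nu> ?A)"
      by (simp only: INF_less_iff)
    then obtain U where U: "?A \<subseteq> U" "open U" "emeasure ?M U < ennreal (\<mu> ?A + \<nu> ?A)"
      by blast
    have Ub: "U \<in> sets borel" and D: "U - ?A \<in> sets borel" using U A by auto
    have lt: "\<mu> U < \<mu> ?A + \<nu> ?A"
      using U(3) em[OF Ub] \<mu>_nonneg[of U] by (simp add: ennreal_less_iff)
    have "\<nu> U = \<nu> ?A + \<nu> (U - ?A)" unfolding \<nu>_def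
      using U(1) by (subst Bochner_Integration.integral_add[symmetric, OF gB[OF A] gB[OF D]])
        (auto intro!: Bochner_Integration.integral_cong split: split_indicator)
    moreover have "\<mu> U = \<mu> ?A + \<mu> (U - ?A)" unfolding \<mu>_def
      using U(1) by (subst Bochner_Integration.integral_add[symmetric, OF gB'[OF A] gB'[OF D]])
        (auto intro!: Bochner_Integration.integral_cong split: split_indicator)
    moreover have "- \<nu> (U - ?A) \<le> \<mu> (U - ?A)"
      unfolding \<nu>_def \<mu>_def using gB[OF D] gB'[OF D]
      by (subst integral_minus[symmetric], intro integral_mono) (auto split: split_indicator)
    ultimately show False using lt open_int[OF U(2)] by linarith
  qed
  have "AE t in lborel. indicator ?A t * g t = 0"
  proof (subst integral_nonneg_eq_0_iff_AE[symmetric])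
    show "integrable lborel (\<lambda>t. indicator ?A t * g t)" by (rule gB[OF A])
    show nn: "AE t in lborel. 0 \<le> indicator ?A t * g t" by (auto split: split_indicator)
    show "(LINT t|lborel. indicator ?A t * g t) = 0"
      using A0 integral_nonneg_AE[OF nn] by (simp add: \<nu>_def)
  qed
  with AE_lborel_singleton[of c] AE_lborel_singleton[of d] show ?thesis
  proof eventually_elim
    case (elim t)
    show ?case
    proof
      assume "t \<in> {c..d}"
      with elim have "g t = f t" by (simp add: g_def)
      with elim(3) show "f t \<le> 0" by (cases "0 < g t") auto
    qed
  qed
qed

text \<open>The set of F. Riesz's rising sun lemma, with the sun to the right: a point is in shadow
  if the graph is higher somewhere later. The right end point \<open>d\<close> may cast a shadow but
  is never itself in it.\<close>

definition shadow :: "real \<Rightarrow> real \<Rightarrow> (real \<Rightarrow> real) \<Rightarrow> real set" where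
  "shadow c d W = {t \<in> {c<..<d}. \<exists>s\<in>{t<..d}. W t < W s}"

lemma open_shadow:
  assumes "continuous_on {c..d} W"
  shows "open (shadow c d W)"
proof -
  have "shadow c d W = (\<Union>s\<in>{c<..d}. {t \<in> {c<..<s}. W t < W s})"
    unfolding shadow_def
  proof (intro set_eqI iffI)
    fix t assume "t \<in> {t \<in> {c<..<d}. \<exists>s\<in>{t<..d}. W t < W s}"
    then obtain s where "c < t" "t < s" "s \<le> d" "W t < W s" by auto
    then show "t \<in> (\<Union>s\<in>{c<..d}. {t \<in> {c<..<s}. W t < W s})" by (intro UN_I[of s]) auto
  qed auto
  moreover have "open {t \<in> {c<..<s}. W t < W s}" if "s \<in> {c<..d}" for s
  proof -
    have "continuous_on {c<..<s} W" using assms that by (elim continuous_on_subset) auto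
    then have "open ({c<..<s} \<inter> W -` {..<W s})" by (intro continuous_open_preimage) auto
    then show ?thesis by (simp add: Int_def vimage_def)
  qed
  ultimately show ?thesis by (auto intro!: open_UN)
qed

text \<open>A left end point \<open>p\<close> is not in shadow, or is \<open>c\<close>, where
  \<open>W\<close> is maximal; so nothing after \<open>p\<close> is higher. If
  \<open>W q < W p\<close>, take \<open>t\<close> in the component with \<open>W t > W q\<close> and
  a maximum point \<open>m\<close> of \<open>W\<close> on \<open>[t, d]\<close>. For
  \<open>m < q\<close> the point \<open>m\<close> would be in shadow below something later;
  otherwise \<open>m\<close> would put \<open>q\<close> in shadow.\<close>

lemma shadow_component:
  assumes W: "continuous_on {c..d} W" and Wc: "\<And>t. t \<in> {c..d} \<Longrightarrow> W t \<le> W c"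
    and pq: "p < q" "{p<..<q} \<subseteq> shadow c d W" "p \<notin> shadow c d W" "q \<notin> shadow c d W"
  shows "c \<le> p" "q \<le> d" "W p = W q"
proof -
  have "{p<..<q} \<subseteq> {c<..<d}" using pq(2) unfolding shadow_def by blast
  then show cp: "c \<le> p" and qd: "q \<le> d"
    using greaterThanLessThan_subseteq_greaterThanLessThan[of p q c d] pq(1) by auto
  have maxp: "W s \<le> W p" if "s \<in> {p..d}" for s
  proof (cases "p = c \<or> s = p")
    case False
    then have "p \<in> {c<..<d}" "s \<in> {p<..d}" using pq(1) cp qd that by auto
    then have "\<not> W p < W s" using pq(3) unfolding shadow_def by blast
    then show ?thesis by simp
  qed (use that Wc[of s] qd in auto)
  have "\<not> W q < W p"
  proof
    assume lt: "W q < W p"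
    have cont: "continuous_on {p..q} W" by (rule continuous_on_subset[OF W]) (use cp qd in auto)
    obtain t where t: "p < t" "t < q" "W q < W t"
    proof -
      \<comment> \<open>The mean of the two end values is taken only to land strictly between them,
        hence at an interior point.\<close>
      obtain t where "p \<le> t" "t \<le> q" "W t = (W p + W q)/2"
        using IVT2'[of W q "(W p + W q)/2" p] lt cont pq(1) by auto
      moreover from this lt have "t \<noteq> p" "t \<noteq> q" by auto
      ultimately show ?thesis using lt that[of t] by auto
    qed
    have "compact {t..d}" "{t..d} \<noteq> {}" using t qd by auto
    moreover have "continuous_on {t..d} W" by (rule continuous_on_subset[OF W]) (use cp t in auto)
    ultimately obtain m where m: "m \<in> {t..d}" "\<And>s. s \<in> {t..d} \<Longrightarrow> W s \<le> W m"
      using continuous_attains_sup[of "{t..d}" W] by blast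
    show False
    proof (cases "m < q")
      case True
      then have "m \<in> {p<..<q}" using m(1) t by auto
      then have "m \<in> shadow c d W" using pq(2) by blast
      then obtain s where "s \<in> {m<..d}" "W m < W s" by (auto simp: shadow_def)
      with m(2)[of s] m(1) show False by auto
    next
      case False
      have "W t \<le> W m" using m(2)[of t] t qd by auto
      with t False have "q < m" "W q < W m" by (auto simp: less_le)
      then have "q \<in> shadow c d W" using m cp pq(1) by (auto simp: shadow_def)
      with pq(4) show False ..
    qed
  qed
  then show "W p = W q" using maxp[of q] pq(1) qd by auto
qed

lemma set_integral_Ioo_eq_Icc:
  fixes f :: "real \<Rightarrow> real"
  shows "(LINT t:{p<..<q}|lborel. f t) = (LINT t:{p..q}|lborel. f t)"
proof (cases "p \<le> q")
  case True
  then show ?thesis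
    using interval_integral_Icc[of p q f] interval_integral_Ioo[of p q f] by simp
qed (simp add: set_lebesgue_integral_def)

text \<open>Between two points outside the shadow, \<open>W\<close> does not increase, while the
  components in between contribute zero. So the part of \<open>f\<close> off the shadow has
  nonpositive integral over every interval.\<close>

lemma AE_nonpos_outside_shadow:
  fixes f :: "real \<Rightarrow> real"
  assumes f: "set_integrable lborel {c..d} f"
    and f_int: "\<And>p q. c \<le> p \<Longrightarrow> p \<le> q \<Longrightarrow> q \<le> d \<Longrightarrow> (LINT t:{p..q}|lborel. f t) = W q - W p"
    and W: "continuous_on {c..d} W" and Wc: "\<And>t. t \<in> {c..d} \<Longrightarrow> W t \<le> W c"
  shows "AE t in lborel. t \<in> {c..d} - shadow c d W \<longrightarrow> f t \<le> 0"
proof -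
  let ?E = "shadow c d W"
  have opE: "open ?E" by (rule open_shadow[OF W])
  define g where "g t = indicator (- ?E) t * f t" for t
  have g_int: "(LINT t:A|lborel. g t) = (LINT t:(A - ?E)|lborel. f t)" for A
    unfolding set_lebesgue_integral_def g_def
    by (auto intro!: Bochner_Integration.integral_cong split: split_indicator)
  have "set_integrable lborel ({c..d} - ?E) f"
    using opE by (intro set_integrable_subset[OF f]) auto
  moreover have "(\<lambda>t. indicator ({c..d} - ?E) t *\<^sub>R f t) = (\<lambda>t. indicator {c..d} t *\<^sub>R g t)"
    by (auto simp: g_def split: split_indicator)
  ultimately have "set_integrable lborel {c..d} g"
    unfolding set_integrable_def by simp
  moreover have "(LINT t:{p<..<q}|lborel. g t) \<le> 0" if pq: "c \<le> p" "p < q" "q \<le> d" for p q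
  proof -
    define K where "K = {p..q} - ?E"
    have "compact K" unfolding K_def using opE by (intro compact_diff) auto
    have "(LINT t:K|lborel. f t) \<le> 0"
    proof (cases "K = {}")
      case False
      \<comment> \<open>Shrinking to the extreme points of \<open>K\<close> loses only shadow
        points, and the new end points are unshaded, so no component is cut in two.\<close>
      define p' q' where "p' = Inf K" and "q' = Sup K"
      have bdd: "bdd_below K" "bdd_above K" and clo: "closed K"
        using \<open>compact K\<close> by (auto intro: bounded_imp_bdd_below bounded_imp_bdd_above
          compact_imp_bounded compact_imp_closed)
      have p'K: "p' \<in> K" and q'K: "q' \<in> K"
        unfolding p'_def q'_def using False bdd clo
        by (auto intro: closed_contains_Inf closed_contains_Sup)
      then have nE: "p' \<notin> ?E" "q' \<notin> ?E" and le: "c \<le> p'" "q' \<le> d"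
        using pq by (auto simp: K_def)
      have K_sub: "K \<subseteq> {p'..q'}"
        unfolding p'_def q'_def using bdd by (auto intro: cInf_lower cSup_upper)
      then have p'q': "p' \<le> q'" using p'K by auto
      define E' where "E' = ?E \<inter> {p'<..<q'}"
      have opE': "open E'" using opE by (simp add: E'_def open_Int)
      have split: "{p'..q'} = K \<union> E'"
      proof
        show "{p'..q'} \<subseteq> K \<union> E'"
        proof
          fix t assume t: "t \<in> {p'..q'}"
          show "t \<in> K \<union> E'"
          proof (cases "t \<in> ?E")
            case True
            with nE t show ?thesis by (auto simp: E'_def less_le)
          next
            case False
            with t p'K q'K show ?thesis by (auto simp: K_def)
          qed
        qed
      qed (use K_sub in \<open>auto simp: E'_def\<close>)
      have fE': "set_integrable lborel E' f"
        using opE' le by (intro set_integrable_subset[OF f]) (auto simp: E'_def)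
      have fK: "set_integrable lborel K f"
        using clo le pq by (intro set_integrable_subset[OF f]) (auto simp: K_def)
      have "(LINT t:{p'..q'}|lborel. f t) = (LINT t:K|lborel. f t) + (LINT t:E'|lborel. f t)"
        unfolding split using fE' fK by (intro set_integral_Un) (auto simp: K_def E'_def)
      moreover have "(LINT t:{p'..q'}|lborel. f t) \<le> 0"
      proof -
        have "W q' \<le> W p'"
        proof (cases "p' = c \<or> p' = q'")
          case True
          then show ?thesis using Wc[of q'] le p'q' by auto
        next
          case False
          then have "p' \<in> {c<..<d}" "q' \<in> {p'<..d}" using le p'q' by auto
          then have "\<not> W p' < W q'" using nE(1) unfolding shadow_def by blast
          then show ?thesis by simp
        qed
        then show ?thesis using f_int[of p' q'] le p'q' by simp
      qed
      \<comment> \<open>The shadow part must be bounded from below, so the component lemma is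
        applied to \<open>- f\<close>.\<close>
      moreover have "(LINT t:E'|lborel. - f t) \<le> 0"
      proof (rule set_integral_open_nonpos[OF opE'])
        show "bounded E'" unfolding E'_def using bounded_Int bounded_box[of p' q'] by auto
        show "set_integrable lborel E' (\<lambda>t. - f t)"
          using fE' unfolding set_integrable_def by simp
        fix r s assume rs: "r < s" "{r<..<s} \<subseteq> E'" "r \<notin> E'" "s \<notin> E'"
        \<comment> \<open>A component of \<open>E'\<close> is a full component of the shadow: each
          of its end points is either \<open>p'\<close>, \<open>q'\<close> or inside
          \<open>{p'<..<q'}\<close>, and in every case unshaded.\<close>
        have "{r<..<s} \<subseteq> {p'<..<q'}" using rs(2) unfolding E'_def by blast
        then have b: "p' \<le> r" "s \<le> q'"
          using greaterThanLessThan_subseteq_greaterThanLessThan[of r s p' q'] rs(1) by auto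
        have "r \<notin> ?E" using rs b nE by (cases "r = p'") (auto simp: E'_def)
        moreover have "s \<notin> ?E" using rs b nE by (cases "s = q'") (auto simp: E'_def)
        ultimately have "W r = W s"
          using shadow_component(3)[OF W Wc, of r s] rs(1,2) by (auto simp: E'_def)
        then have "(LINT t:{r<..<s}|lborel. f t) = 0"
          using f_int[of r s] b rs(1) le by (simp add: set_integral_Ioo_eq_Icc)
        then show "(LINT t:{r<..<s}|lborel. - f t) \<le> 0"
          by (simp add: set_lebesgue_integral_def)
      qed
      then have "0 \<le> (LINT t:E'|lborel. f t)" by (simp add: set_lebesgue_integral_def)
      ultimately show ?thesis by linarith
    qed (simp add: set_lebesgue_integral_def)
    then show ?thesis unfolding set_integral_Ioo_eq_Icc by (simp only: g_int K_def)
  qed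
  ultimately have "AE t in lborel. t \<in> {c..d} \<longrightarrow> g t \<le> 0"
    by (rule AE_nonpos_if_interval_integrals_nonpos)
  then show ?thesis by eventually_elim (auto simp: g_def)
qed



text \<open>The primitive \<open>W\<close> need not be maximal at \<open>c\<close>. It starts at 0
  and ends at a value at most 0, so up to its last zero \<open>m\<close> the whole interval serves
  as one component; after \<open>m\<close> it stays below \<open>W m\<close>, and the shadow on
  \<open>[m, d]\<close> applies.\<close>

theorem rising_sun:
  fixes f :: "real \<Rightarrow> real"
  assumes f: "set_integrable lborel {c..d} f" and "c \<le> d"
    and nonpos: "(LINT t:{c..d}|lborel. f t) \<le> 0"
  obtains E where "open E" "E \<subseteq> {c<..<d}"
    "\<And>p q. p < q \<Longrightarrow> {p<..<q} \<subseteq> E \<Longrightarrow> p \<notin> E \<Longrightarrow> q \<notin> E \<Longrightarrow> (LINT t:{p<..<q}|lborel. f t) = 0"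
    "AE t in lborel. t \<in> {c..d} - E \<longrightarrow> f t \<le> 0"
proof -
  define W where "W t = integral {c..t} f" for t
  have fi: "f integrable_on {c..d}" using set_borel_integral_eq_integral[OF f] by blast
  have f_int: "(LINT t:{p..q}|lborel. f t) = W q - W p" if pq: "c \<le> p" "p \<le> q" "q \<le> d" for p q
  proof -
    have "set_integrable lborel {p..q} f" by (rule set_integrable_subset[OF f]) (use pq in auto)
    then have "(LINT t:{p..q}|lborel. f t) = integral {p..q} f" by (rule set_borel_integral_eq_integral)
    moreover have "integral {c..p} f + integral {p..q} f = integral {c..q} f"
      using pq by (intro Henstock_Kurzweil_Integration.integral_combine integrable_subinterval_real[OF fi]) auto
    ultimately show ?thesis by (simp add: W_def)
  qed
  have W: "continuous_on {c..d} W" unfolding W_def by (rule indefinite_integral_continuous_1[OF fi])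
  have Wc: "W c = 0" by (simp add: W_def)
  define m where "m = Sup {t \<in> {c..d}. 0 \<le> W t}"
  have clo: "closed {t \<in> {c..d}. 0 \<le> W t}"
    using continuous_closed_preimage[OF W, of "{0..}"] by (simp add: Int_def vimage_def)
  have "c \<in> {t \<in> {c..d}. 0 \<le> W t}" using Wc \<open>c \<le> d\<close> by simp
  moreover have bdd: "bdd_above {t \<in> {c..d}. 0 \<le> W t}" by (auto intro: bdd_aboveI[of _ d])
  ultimately have "m \<in> {t \<in> {c..d}. 0 \<le> W t}"
    unfolding m_def using clo by (intro closed_contains_Sup) auto
  then have m: "c \<le> m" "m \<le> d" "0 \<le> W m" by auto
  have after: "W t < 0" if "m < t" "t \<le> d" for t
  proof (rule ccontr)
    assume "\<not> W t < 0"
    then have "t \<le> m" unfolding m_def using that m(1) bdd by (intro cSup_upper) auto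
    with that show False by simp
  qed
  have Wm: "W m = 0"
  proof (rule ccontr)
    assume "W m \<noteq> 0"
    then have pos: "0 < W m" using m by simp
    have "W d \<le> 0" using f_int[of c d] nonpos \<open>c \<le> d\<close> Wc by simp
    moreover have "continuous_on {m..d} W" by (rule continuous_on_subset[OF W]) (use m in auto)
    ultimately obtain t where "m \<le> t" "t \<le> d" "W t = 0"
      using IVT2'[of W d 0 m] pos m by auto
    then show False using after[of t] pos by (cases "m = t") auto
  qed
  let ?S = "shadow m d W"
  have contm: "continuous_on {m..d} W" by (rule continuous_on_subset[OF W]) (use m in auto)
  have Wle: "W t \<le> W m" if "t \<in> {m..d}" for t
    using that after[of t] Wm by (cases "t = m") auto
  define E where "E = {c<..<m} \<union> ?S"
  have S_sub: "?S \<subseteq> {m<..<d}" by (auto simp: shadow_def)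
  show ?thesis
  proof
    show "open E" unfolding E_def using open_shadow[OF contm] by auto
    show "E \<subseteq> {c<..<d}" using S_sub m by (force simp: E_def)
    show "(LINT t:{p<..<q}|lborel. f t) = 0"
      if pq: "p < q" "{p<..<q} \<subseteq> E" "p \<notin> E" "q \<notin> E" for p q
    proof -
      \<comment> \<open>The point \<open>m\<close> separates the two pieces of \<open>E\<close>, so
        every component lies on one side of it.\<close>
      have "m \<notin> E" using S_sub by (auto simp: E_def)
      then have "\<not> (p < m \<and> m < q)" using pq(2) by auto
      then consider "q \<le> m" | "m \<le> p" by linarith
      then have "c \<le> p \<and> q \<le> d \<and> W p = W q"
      proof cases
        case 1
        then have "{p<..<q} \<subseteq> {c<..<m}" using pq(2) S_sub by (fastforce simp: E_def)
        then have "c \<le> p" "q \<le> m"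
          using greaterThanLessThan_subseteq_greaterThanLessThan[of p q c m] pq(1) by auto
        with pq have "p = c" "q = m" by (auto simp: E_def)
        then show ?thesis using Wc Wm m by simp
      next
        case 2
        then have "{p<..<q} \<subseteq> ?S" using pq(2) by (force simp: E_def)
        with pq(1,3,4) shadow_component[OF contm Wle, of p q] m show ?thesis
          by (auto simp: E_def)
      qed
      then show ?thesis using f_int[of p q] pq(1) by (simp add: set_integral_Ioo_eq_Icc)
    qed
    have "AE t in lborel. t \<in> {m..d} - ?S \<longrightarrow> f t \<le> 0"
    proof (rule AE_nonpos_outside_shadow[OF _ _ contm Wle])
      show "set_integrable lborel {m..d} f" by (rule set_integrable_subset[OF f]) (use m in auto)
    qed (use f_int m in auto)
    \<comment> \<open>Of the points before \<open>m\<close>, only \<open>c\<close> can lie outside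
      \<open>E\<close>.\<close>
    then show "AE t in lborel. t \<in> {c..d} - E \<longrightarrow> f t \<le> 0"
      using AE_lborel_singleton[of c] by eventually_elim (auto simp: E_def)
  qed
qed

section \<open>Superlevel sets of an \<open>RH\<^sub>1\<close> weight\<close>

text \<open>The function \<open>G\<close> of the overview, with the level as first argument. On an
  interval \<open>J\<close> where \<open>w\<close> has mean \<open>L\<close>, its integral is
  \<open>\<bar>J\<bar> L\<close> times the normalized entropy minus \<open>Q\<close>.\<close>

definition defect :: "real \<Rightarrow> real \<Rightarrow> real \<Rightarrow> real" where
  "defect Q L s = s * ln s - s * ln L - (1 + Q) * s + L"

lemma diff_ln_mono:
  fixes a b :: real
  assumes "1 \<le> a" "a \<le> b"
  shows "a - ln a \<le> b - ln b"
proof -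
  have "ln b - ln a = ln (b / a)" using assms by (simp add: ln_div)
  also have "\<dots> \<le> b / a - 1" using assms by (intro ln_le_minus_one) auto
  also have "\<dots> = (b - a) / a" using assms by (simp add: field_simps)
  also have "\<dots> \<le> (b - a) / 1" using assms by (intro divide_left_mono) auto
  finally show ?thesis by simp
qed

text \<open>Up to the factor \<open>s\<close>, the defect depends only on \<open>L / s\<close>.
  Since \<open>u - ln u\<close> increases for \<open>u \<ge> 1\<close> and equals
  \<open>Q + 1\<close> at \<open>\<gamma>\<close>, its sign is decided by comparing
  \<open>L / s\<close> with \<open>\<gamma>\<close>.\<close>

lemma defect_eq: "0 < s \<Longrightarrow> 0 < L \<Longrightarrow> defect Q L s = s * (L / s - ln (L / s) - (Q + 1))"
  by (simp add: defect_def ln_div field_simps)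

lemma defect_nonpos:
  assumes "\<gamma> - ln \<gamma> = Q + 1" "0 < s" "s \<le> L" "L \<le> \<gamma> * s"
  shows "defect Q L s \<le> 0"
proof -
  have "L / s - ln (L / s) \<le> \<gamma> - ln \<gamma>"
    using assms by (intro diff_ln_mono) (auto simp: field_simps)
  with assms show ?thesis by (simp add: defect_eq mult_nonneg_nonpos)
qed

lemma defect_nonneg:
  assumes "\<gamma> - ln \<gamma> = Q + 1" "1 \<le> \<gamma>" "0 < s" "\<gamma> * s \<le> L"
  shows "0 \<le> defect Q L s"
proof -
  have "\<gamma> - ln \<gamma> \<le> L / s - ln (L / s)"
    using assms by (intro diff_ln_mono) (auto simp: field_simps)
  moreover have "0 < L" using assms by (smt (verit) mult_pos_pos)
  ultimately show ?thesis using assms by (simp add: defect_eq)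
qed

lemma avg_normalized_entropy:
  assumes w: "set_integrable lborel {p..q} w" and wl: "set_integrable lborel {p..q} (\<lambda>t. w t * ln (w t))"
    and pos: "AE t in lborel. t \<in> {p..q} \<longrightarrow> 0 < w t" and m: "0 < m" "m = avg p q w" and "p < q"
  shows "avg p q (\<lambda>t. w t / m * ln (w t / m)) = avg p q (\<lambda>t. w t * ln (w t)) / m - ln m"
proof -
  \<comment> \<open>Measurability is available only for the product of \<open>w\<close> with the
    indicator. The factor \<open>u t\<close> makes all terms vanish off the interval, whatever the
    logarithm of 0 is.\<close>
  define u where "u t = indicator {p..q} t * w t" for t
  have [measurable]: "u \<in> borel_measurable borel"
    using borel_measurable_integrable[OF w[unfolded set_integrable_def]] by (simp add: u_def[abs_def])
  have ind: "indicator {p..q} t *\<^sub>R (w t * ln (w t)) = u t * ln (u t)"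
    "indicator {p..q} t *\<^sub>R (w t / m * ln (w t / m)) = u t / m * ln (u t / m)"
    "indicator {p..q} t *\<^sub>R w t = u t" for t
    by (auto simp: u_def split: split_indicator)
  have ui: "integrable lborel u" "integrable lborel (\<lambda>t. u t * ln (u t))"
    using w wl unfolding set_integrable_def ind by simp_all
  have "(LINT t|lborel. u t / m * ln (u t / m)) = (LINT t|lborel. u t * ln (u t) / m - ln m / m * u t)"
  proof (rule integral_cong_AE)
    show "AE t in lborel. u t / m * ln (u t / m) = u t * ln (u t) / m - ln m / m * u t"
      using pos
    proof eventually_elim
      case (elim t)
      then show ?case using m(1)
        by (cases "t \<in> {p..q}") (auto simp: u_def ln_div field_simps)
    qed
  qed simp_all
  also have "\<dots> = (LINT t|lborel. u t * ln (u t)) / m - ln m / m * (LINT t|lborel. u t)"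
    using ui by simp
  finally have *: "(LINT t|lborel. u t / m * ln (u t / m)) =
    (LINT t|lborel. u t * ln (u t)) / m - ln m / m * (LINT t|lborel. u t)" .
  have "m = (LINT t|lborel. u t) / (q - p)"
    unfolding m(2) avg_def set_lebesgue_integral_def ind ..
  then have "(LINT t|lborel. u t) = m * (q - p)" using \<open>p < q\<close> by simp
  with * have "(LINT t|lborel. u t / m * ln (u t / m)) =
      (LINT t|lborel. u t * ln (u t)) / m - ln m * (q - p)"
    using m(1) by simp
  then show ?thesis
    unfolding avg_def set_lebesgue_integral_def ind using \<open>p < q\<close> by (simp add: diff_divide_distrib)
qed

lemma set_integrable_defect:
  fixes p q :: real
  assumes "set_integrable lborel {p..q} w" "set_integrable lborel {p..q} (\<lambda>t. w t * ln (w t))"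
  shows "set_integrable lborel {p..q} (\<lambda>t. defect Q L (w t))"
    and "(LINT t:{p..q}|lborel. defect Q L (w t)) =
      (LINT t:{p..q}|lborel. w t * ln (w t)) - (ln L + (1 + Q)) * (LINT t:{p..q}|lborel. w t)
        + (LINT t:{p..q}|lborel. L)"
proof -
  have eq: "defect Q L (w t) = w t * ln (w t) - (ln L + (1 + Q)) * w t + L" for t
    by (simp add: defect_def algebra_simps)
  have c: "set_integrable lborel {p..q} (\<lambda>t. L)"
    by (rule borel_integrable_atLeastAtMost') simp
  show "set_integrable lborel {p..q} (\<lambda>t. defect Q L (w t))"
    unfolding eq using assms c by (intro set_integral_add set_integral_diff set_integrable_mult_right) auto
  show "(LINT t:{p..q}|lborel. defect Q L (w t)) =
      (LINT t:{p..q}|lborel. w t * ln (w t)) - (ln L + (1 + Q)) * (LINT t:{p..q}|lborel. w t)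
        + (LINT t:{p..q}|lborel. L)"
    unfolding eq using assms c by (simp add: set_integral_add set_integral_diff)
qed

text \<open>This is the \<open>RH\<^sub>1\<close> inequality on \<open>[p, q]\<close>, multiplied by
  \<open>(q - p) * L\<close>.\<close>

lemma integral_defect_interval_nonpos:
  assumes adm: "admissible Q x y w" and pq: "0 \<le> p" "p < q" "q \<le> 1"
    and L: "0 < L" "avg p q w = L"
  shows "(LINT t:{p..q}|lborel. defect Q L (w t)) \<le> 0"
proof -
  have w: "set_integrable lborel {p..q} w" and wl: "set_integrable lborel {p..q} (\<lambda>t. w t * ln (w t))"
    using adm pq by (auto simp: admissible_def weight01_def intro: set_integrable_subset[where A="{0..1}"])
  have "AE t in lborel. t \<in> {0..1} \<longrightarrow> 0 < w t" using adm by (simp add: admissible_def weight01_def)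
  then have pos: "AE t in lborel. t \<in> {p..q} \<longrightarrow> 0 < w t"
    by eventually_elim (use pq in auto)
  have "ereal (avg p q (\<lambda>t. w t / avg p q w * ln (w t / avg p q w))) \<le> rh1 w"
    unfolding rh1_def using pq by (intro Sup_upper) auto
  also have "\<dots> \<le> ereal Q" using adm by (simp add: admissible_def)
  finally have "avg p q (\<lambda>t. w t / L * ln (w t / L)) \<le> Q" using L by simp
  then have "avg p q (\<lambda>t. w t * ln (w t)) / L - ln L \<le> Q"
    using avg_normalized_entropy[OF w wl pos L(1) L(2)[symmetric] pq(2)] by simp
  then have "(LINT t:{p..q}|lborel. w t * ln (w t)) \<le> (q - p) * L * (Q + ln L)"
    using L(1) pq(2) by (simp add: avg_def field_simps)
  moreover have w_int: "(LINT t:{p..q}|lborel. w t) = (q - p) * L"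
    using L(2) pq(2) by (simp add: avg_def field_simps)
  moreover have L_int: "(LINT t:{p..q}|lborel. L) = (q - p) * L"
    using pq by (simp add: set_lebesgue_integral_def)
  ultimately show ?thesis
    unfolding set_integrable_defect(2)[OF w wl] w_int L_int by (simp add: algebra_simps)
qed

text \<open>
  The superlevel set \<open>S = {\<gamma> w \<ge> L}\<close> is compared with the rising sun set \<open>E\<close> of level \<open>L\<close>: the
  defect is nonpositive on \<open>S - E\<close> because \<open>w \<le> L\<close> there, and nonnegative on \<open>E - S\<close>.
\<close>

lemma integral_defect_superlevel_nonpos:
  assumes adm: "admissible Q x y w" and \<gamma>: "\<gamma> - ln \<gamma> = Q + 1" "1 \<le> \<gamma>" and L: "0 < L" "x \<le> L"
  shows "(LINT t:{t \<in> {0..1}. L \<le> \<gamma> * w t}|lborel. defect Q L (w t)) \<le> 0"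
proof -
  have w: "set_integrable lborel {0..1} w" and wl: "set_integrable lborel {0..1} (\<lambda>t. w t * ln (w t))"
    and pos: "AE t in lborel. t \<in> {0..1} \<longrightarrow> 0 < w t"
    and x: "(LINT t:{0..1}|lborel. w t) = x"
    using adm by (auto simp: admissible_def weight01_def avg_def)
  define S where "S = {t \<in> {0..1}. L \<le> \<gamma> * w t}"
  define u where "u t = indicator {0..1} t * w t" for t
  have [measurable]: "u \<in> borel_measurable borel"
    using borel_measurable_integrable[OF w[unfolded set_integrable_def]] by (simp add: u_def[abs_def])
  \<comment> \<open>Points off the unit interval have \<open>u t = 0\<close> and are excluded
    because \<open>L > 0\<close>.\<close>
  have "S = {t. L \<le> \<gamma> * u t}" using L(1) by (auto simp: S_def u_def split: split_indicator)
  then have Sm: "S \<in> sets borel" by simp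
  have c: "set_integrable lborel {p..q} (\<lambda>t. L)" for p q :: real
    by (rule borel_integrable_atLeastAtMost') simp
  have Lint: "(LINT t:{p..q}|lborel. L) = L * (q - p)" if "p \<le> q" for p q :: real
    using that by (simp add: set_lebesgue_integral_def)
  have f: "set_integrable lborel {0..1} (\<lambda>t. w t - L)" using w c by (intro set_integral_diff)
  have "(LINT t:{0..1}|lborel. w t - L) = x - L"
    using w c x Lint[of 0 1] by (simp add: set_integral_diff)
  with L(2) have "(LINT t:{0..1}|lborel. w t - L) \<le> 0" by simp
  then obtain E where E: "open E" "E \<subseteq> {0<..<1}"
    and comp: "\<And>p q. p < q \<Longrightarrow> {p<..<q} \<subseteq> E \<Longrightarrow> p \<notin> E \<Longrightarrow> q \<notin> E \<Longrightarrow> (LINT t:{p<..<q}|lborel. w t - L) = 0"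
    and off: "AE t in lborel. t \<in> {0..1} - E \<longrightarrow> w t - L \<le> 0"
    using rising_sun[OF f] by auto
  have D: "set_integrable lborel {0..1} (\<lambda>t. defect Q L (w t))" by (rule set_integrable_defect(1)[OF w wl])
  have DE: "set_integrable lborel E (\<lambda>t. defect Q L (w t))"
    by (rule set_integrable_subset[OF D]) (use E in auto)
  have DS: "set_integrable lborel S (\<lambda>t. defect Q L (w t))"
    by (rule set_integrable_subset[OF D]) (use Sm in \<open>auto simp: S_def\<close>)
  have "(LINT t:E|lborel. defect Q L (w t)) \<le> 0"
  proof (rule set_integral_open_nonpos[OF E(1) _ DE])
    show "bounded E" using bounded_subset[OF bounded_box[of 0 "1::real"], of E] E(2) by simp
    fix p q :: real assume pq: "p < q" "{p<..<q} \<subseteq> E" "p \<notin> E" "q \<notin> E"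
    have "{p<..<q} \<subseteq> {0<..<1}" using pq E(2) by blast
    then have b: "0 \<le> p" "q \<le> 1"
      using greaterThanLessThan_subseteq_greaterThanLessThan[of p q 0 1] pq(1) by auto
    have wpq: "set_integrable lborel {p..q} w" by (rule set_integrable_subset[OF w]) (use b in auto)
    have "(LINT t:{p..q}|lborel. w t - L) = 0" using comp[OF pq] by (simp add: set_integral_Ioo_eq_Icc)
    then have "avg p q w = L"
      using wpq c Lint[of p q] pq(1) by (simp add: set_integral_diff avg_def)
    then show "(LINT t:{p<..<q}|lborel. defect Q L (w t)) \<le> 0"
      using integral_defect_interval_nonpos[OF adm b(1) pq(1) b(2) L(1)]
      by (simp add: set_integral_Ioo_eq_Icc)
  qed
  moreover have "(LINT t:S|lborel. defect Q L (w t)) \<le> (LINT t:E|lborel. defect Q L (w t))"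
    unfolding set_lebesgue_integral_def
  proof (rule integral_mono_AE)
    show "AE t in lborel. indicator S t *\<^sub>R defect Q L (w t) \<le> indicator E t *\<^sub>R defect Q L (w t)"
      using pos off
    proof eventually_elim
      case (elim t)
      show ?case
      proof (cases "t \<in> {0..1}")
        case True
        with elim have wt: "0 < w t" "t \<notin> E \<Longrightarrow> w t \<le> L" by auto
        show ?thesis
          using defect_nonpos[OF \<gamma>(1) wt(1), of L] wt defect_nonneg[OF \<gamma> wt(1), of L] True
          by (auto simp: S_def split: split_indicator)
      next
        case False
        then have "t \<notin> S" "t \<notin> E" using E(2) by (auto simp: S_def)
        then show ?thesis by simp
      qed
    qed
  qed (use DE DS in \<open>auto simp: set_integrable_def\<close>)
  ultimately show ?thesis by (simp add: S_def)
qed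

section \<open>The upper bound\<close>

text \<open>
  An antiderivative of \<open>L \<mapsto> G(s, L) L\<^sup>\<epsilon>\<^sup>-\<^sup>1\<close>, chosen to vanish at \<open>L = 0\<close>.
\<close>

definition defect_prim :: "real \<Rightarrow> real \<Rightarrow> real \<Rightarrow> real \<Rightarrow> real" where
  "defect_prim \<epsilon> Q s L =
     L powr \<epsilon> * (L / (1 + \<epsilon>) + s * ln s / \<epsilon> - s * ln L / \<epsilon> + s / \<epsilon>\<^sup>2 - (1 + Q) * s / \<epsilon>)"

lemma DERIV_defect_prim:
  assumes "0 < L" "0 < \<epsilon>"
  shows "(defect_prim \<epsilon> Q s has_real_derivative defect Q L s * L powr (\<epsilon> - 1)) (at L)"
proof -
  define P where "P = L powr (\<epsilon> - 1)"
  define B where "B = L / (1 + \<epsilon>) + s * ln s / \<epsilon> - s * ln L / \<epsilon> + s / \<epsilon>\<^sup>2 - (1 + Q) * s / \<epsilon>"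
  have LP: "L powr \<epsilon> = L * P" using assms(1) by (simp add: P_def powr_diff)
  have e1: "1 + \<epsilon> \<noteq> 0" using assms by simp
  have dB: "((\<lambda>L. L / (1 + \<epsilon>) + s * ln s / \<epsilon> - s * ln L / \<epsilon> + s / \<epsilon>\<^sup>2 - (1 + Q) * s / \<epsilon>)
      has_real_derivative 1 / (1 + \<epsilon>) - s / (\<epsilon> * L)) (at L)"
    using assms by (auto intro!: derivative_eq_intros)
  have deriv: "(defect_prim \<epsilon> Q s has_real_derivative
      \<epsilon> * P * B + L powr \<epsilon> * (1 / (1 + \<epsilon>) - s / (\<epsilon> * L))) (at L)"
    unfolding defect_prim_def[abs_def] B_def P_def
    using DERIV_mult[OF has_real_derivative_powr[OF assms(1), of \<epsilon>] dB] by (simp add: mult.commute)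
  have "\<epsilon> * P * B + L powr \<epsilon> * (1 / (1 + \<epsilon>) - s / (\<epsilon> * L)) =
      P * (\<epsilon> * B + L * (1 / (1 + \<epsilon>)) - L * (s / (\<epsilon> * L)))"
    by (simp add: LP algebra_simps)
  also have "L * (s / (\<epsilon> * L)) = s / \<epsilon>" using assms by simp
  also have "\<epsilon> * B = \<epsilon> * (L / (1 + \<epsilon>)) + s * ln s - s * ln L + s / \<epsilon> - (1 + Q) * s"
    using assms(2) by (simp add: B_def distrib_left right_diff_distrib power2_eq_square)
  also have "\<epsilon> * (L / (1 + \<epsilon>)) = L - L * (1 / (1 + \<epsilon>))" using e1 by (simp add: field_simps)
  finally have "\<epsilon> * P * B + L powr \<epsilon> * (1 / (1 + \<epsilon>) - s / (\<epsilon> * L)) = defect Q L s * P"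
    by (simp add: defect_def mult.commute)
  with deriv show ?thesis by (simp add: P_def)
qed

section \<open>Integrating the superlevel inequality over the level\<close>

lemma integrable_pair_mult:
  fixes f g :: "real \<Rightarrow> real"
  assumes "integrable lborel f" "integrable lborel g"
  shows "integrable (lborel \<Otimes>\<^sub>M lborel) (\<lambda>(s, t). f s * g t)"
proof (rule lborel_pair.Fubini_integrable)
  have [measurable]: "f \<in> borel_measurable borel" "g \<in> borel_measurable borel"
    using assms by (auto dest: borel_measurable_integrable)
  show "(\<lambda>(s, t). f s * g t) \<in> borel_measurable (lborel \<Otimes>\<^sub>M lborel)" by measurable
qed (use assms in \<open>simp_all add: abs_mult\<close>)

locale rh1_params =
  fixes Q \<epsilon> \<gamma> :: real
  assumes gamma_root: "\<gamma> - ln \<gamma> = Q + 1" and gamma_gt_1: "1 < \<gamma>"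
    and eps_pos: "0 < \<epsilon>" and eps_bound: "\<epsilon> * (\<gamma> - 1) < 1"
begin

text \<open>The factor of \<open>s powr (1 + \<epsilon>)\<close> in \<open>defect_prim\<close> at
  the level \<open>L = \<gamma> s\<close>.\<close>

definition moment_const :: real where
  "moment_const = \<gamma> powr \<epsilon> * (1 + \<epsilon> - \<gamma> * \<epsilon>) / (\<epsilon>\<^sup>2 * (1 + \<epsilon>))"

lemma denom_pos: "0 < 1 + \<epsilon> - \<gamma> * \<epsilon>"
  using eps_bound by (simp add: algebra_simps)

lemma moment_const_pos: "0 < moment_const"
  using denom_pos eps_pos gamma_gt_1 by (simp add: moment_const_def)

lemma kernel_const_eq:
  "\<gamma> / (1 + \<epsilon>) - \<gamma> / \<epsilon> + 1 / \<epsilon>\<^sup>2 = (1 + \<epsilon> - \<gamma> * \<epsilon>) / (\<epsilon>\<^sup>2 * (1 + \<epsilon>))"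
proof -
  have "1 + \<epsilon> \<noteq> 0" "\<epsilon> \<noteq> 0" using eps_pos by auto
  then show ?thesis by (simp add: divide_simps) (simp add: power2_eq_square algebra_simps)
qed

text \<open>At this level the root equation gives \<open>ln L + 1 + Q = \<gamma> + ln s\<close>, so
  the logarithms cancel and a pure power of \<open>s\<close> remains.\<close>

lemma defect_prim_at_gamma:
  assumes "0 < s"
  shows "defect_prim \<epsilon> Q s (\<gamma> * s) = moment_const * s powr (1 + \<epsilon>)"
proof -
  have "\<gamma> * s / (1 + \<epsilon>) + s * ln s / \<epsilon> - s * ln (\<gamma> * s) / \<epsilon> + s / \<epsilon>\<^sup>2 - (1 + Q) * s / \<epsilon>
      = s * (\<gamma> / (1 + \<epsilon>) - \<gamma> / \<epsilon> + 1 / \<epsilon>\<^sup>2)"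
  proof -
    have "s * ln (\<gamma> * s) / \<epsilon> + (1 + Q) * s / \<epsilon> = s * (ln (\<gamma> * s) + (1 + Q)) / \<epsilon>"
      by (simp add: algebra_simps add_divide_distrib)
    also have "ln (\<gamma> * s) + (1 + Q) = \<gamma> + ln s"
      using assms gamma_gt_1 gamma_root by (simp add: ln_mult)
    finally show ?thesis by (simp add: algebra_simps add_divide_distrib)
  qed
  also note kernel_const_eq
  finally show ?thesis
    using assms gamma_gt_1 by (simp add: defect_prim_def moment_const_def powr_mult powr_add)
qed

text \<open>After scaling by \<open>u = L / s\<close>, the bracket is decreasing in \<open>u\<close>
  on \<open>(0, \<gamma>]\<close> and positive at \<open>\<gamma>\<close>. The proof uses the
  tangent bound for \<open>ln\<close> at \<open>\<gamma>\<close>. The result allows the value at a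
  cut-off level below \<open>\<gamma> s\<close> to be dropped.\<close>

lemma defect_prim_nonneg:
  assumes "0 < L" "L \<le> \<gamma> * s"
  shows "0 \<le> defect_prim \<epsilon> Q s L"
proof -
  have s: "0 < s" using assms gamma_gt_1 by (smt (verit) mult_nonneg_nonpos)
  have e1: "0 < 1 + \<epsilon>" using eps_pos by simp
  define u where "u = L / s"
  have u: "0 < u" "u \<le> \<gamma>" using assms s by (auto simp: u_def field_simps)
  have L: "L = s * u" using s by (simp add: u_def)
  have "ln (u / \<gamma>) \<le> u / \<gamma> - 1" using u gamma_gt_1 by (intro ln_le_minus_one) auto
  then have "ln u \<le> ln \<gamma> - (\<gamma> - u) / \<gamma>"
    using u gamma_gt_1 by (simp add: ln_div field_simps)
  \<comment> \<open>Here the bound on \<open>\<epsilon>\<close> enters, in the form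
    \<open>\<gamma> * \<epsilon> \<le> 1 + \<epsilon>\<close>.\<close>
  moreover have "\<epsilon> / (1 + \<epsilon>) \<le> 1 / \<gamma>" using denom_pos e1 gamma_gt_1 by (simp add: field_simps)
  then have "(\<gamma> - u) * (\<epsilon> / (1 + \<epsilon>)) \<le> (\<gamma> - u) * (1 / \<gamma>)"
    using u by (intro mult_left_mono) auto
  ultimately have "ln u \<le> ln \<gamma> - (\<gamma> - u) * (\<epsilon> / (1 + \<epsilon>))" by simp
  then have "ln u + (1 + Q) \<le> \<gamma> - (\<gamma> - u) * (\<epsilon> / (1 + \<epsilon>))"
    using gamma_root by simp
  then have "(ln u + (1 + Q)) / \<epsilon> \<le> (\<gamma> - (\<gamma> - u) * (\<epsilon> / (1 + \<epsilon>))) / \<epsilon>"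
    using eps_pos by (intro divide_right_mono) auto
  also have "\<dots> = \<gamma> / \<epsilon> - (\<gamma> - u) / (1 + \<epsilon>)"
    using eps_pos e1 by (simp add: diff_divide_distrib)
  finally have "u / (1 + \<epsilon>) - (ln u + (1 + Q)) / \<epsilon> + 1 / \<epsilon>\<^sup>2 \<ge> \<gamma> / (1 + \<epsilon>) - \<gamma> / \<epsilon> + 1 / \<epsilon>\<^sup>2"
    by (simp add: diff_divide_distrib)
  also note kernel_const_eq
  finally have "0 \<le> u / (1 + \<epsilon>) - (ln u + (1 + Q)) / \<epsilon> + 1 / \<epsilon>\<^sup>2"
    using denom_pos e1 by (smt (verit) divide_nonneg_nonneg mult_nonneg_nonneg zero_le_power2)
  moreover have "defect_prim \<epsilon> Q s L =
      L powr \<epsilon> * (s * (u / (1 + \<epsilon>) - (ln u + (1 + Q)) / \<epsilon> + 1 / \<epsilon>\<^sup>2))"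
    using s u unfolding defect_prim_def L by (simp add: ln_mult add_divide_distrib algebra_simps)
  ultimately show ?thesis using s by simp
qed

lemma defect_prim_mono:
  assumes "0 < s" "\<gamma> * s \<le> L"
  shows "defect_prim \<epsilon> Q s (\<gamma> * s) \<le> defect_prim \<epsilon> Q s L"
proof (rule DERIV_nonneg_imp_nondecreasing[OF assms(2)])
  fix z assume z: "\<gamma> * s \<le> z" "z \<le> L"
  then have "0 < z" using assms gamma_gt_1 by (smt (verit) mult_pos_pos)
  moreover have "0 \<le> defect Q z s"
    using z assms gamma_gt_1 by (intro defect_nonneg[OF gamma_root]) auto
  ultimately show "\<exists>y. DERIV (defect_prim \<epsilon> Q s) z :> y \<and> 0 \<le> y"
    using DERIV_defect_prim[OF _ eps_pos, of z Q s]
    by (intro exI[of _ "defect Q z s * z powr (\<epsilon> - 1)"]) auto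
qed

lemma integral_defect_kernel:
  assumes "0 < a" "a \<le> b"
  shows "(LINT L:{a..b}|lborel. defect Q L s * L powr (\<epsilon> - 1)) =
    defect_prim \<epsilon> Q s b - defect_prim \<epsilon> Q s a"
  unfolding set_lebesgue_integral_def real_scaleR_def mult.commute[of "indicator _ _"]
proof (rule integral_FTC_Icc_real)
  fix z assume "a \<le> z" "z \<le> b"
  then have "0 < z" using assms by simp
  then show "DERIV (defect_prim \<epsilon> Q s) z :> defect Q z s * z powr (\<epsilon> - 1)"
    by (rule DERIV_defect_prim[OF _ eps_pos])
  show "isCont (\<lambda>L. defect Q L s * L powr (\<epsilon> - 1)) z"
    using \<open>0 < z\<close> unfolding defect_def by (auto intro!: continuous_intros)
qed (rule assms)

text \<open>Equality holds if \<open>a \<le> \<gamma> s \<le> b\<close>. If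
  \<open>\<gamma> s > b\<close>, a nonnegative value of \<open>defect_prim\<close> at
  \<open>b\<close> is dropped. If \<open>\<gamma> s < a\<close>, the integral is empty and
  \<open>defect_prim\<close> has only grown between \<open>\<gamma> s\<close> and
  \<open>a\<close>.\<close>

lemma truncated_kernel_lower_bound:
  assumes s: "0 < s" and a: "0 < a" "a \<le> b"
  shows "moment_const * s powr (1 + \<epsilon>) * (if \<gamma> * s \<le> b then 1 else 0) - defect_prim \<epsilon> Q s a
    \<le> (LINT L:{a..min b (\<gamma> * s)}|lborel. defect Q L s * L powr (\<epsilon> - 1))"
proof (cases "a \<le> \<gamma> * s")
  case True
  then have "(LINT L:{a..min b (\<gamma> * s)}|lborel. defect Q L s * L powr (\<epsilon> - 1)) =
      defect_prim \<epsilon> Q s (min b (\<gamma> * s)) - defect_prim \<epsilon> Q s a"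
    using a by (intro integral_defect_kernel) auto
  then show ?thesis
    using defect_prim_nonneg[of b s] defect_prim_at_gamma[OF s] a by (auto simp: min_def)
next
  case False
  then have "(LINT L:{a..min b (\<gamma> * s)}|lborel. defect Q L s * L powr (\<epsilon> - 1)) = 0"
    using a by (simp add: set_lebesgue_integral_def)
  moreover have "defect_prim \<epsilon> Q s (\<gamma> * s) \<le> defect_prim \<epsilon> Q s a"
    using False by (intro defect_prim_mono[OF s]) auto
  ultimately show ?thesis
    using False a by (simp add: defect_prim_at_gamma[OF s])
qed

text \<open>
  The level is cut off at \<open>b\<close> because \<open>w powr (1 + \<epsilon>)\<close> is not known to be integrable beforehand.
\<close>

lemma truncated_moment_bound:
  assumes adm: "admissible Q x y w" and a: "0 < a" "x \<le> a" "a \<le> b"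
  shows "set_integrable lborel {0..1} (\<lambda>t. w t powr (1 + \<epsilon>) * (if \<gamma> * w t \<le> b then 1 else 0))"
    and "moment_const * (LINT t:{0..1}|lborel. w t powr (1 + \<epsilon>) * (if \<gamma> * w t \<le> b then 1 else 0))
      \<le> (LINT t:{0..1}|lborel. defect_prim \<epsilon> Q (w t) a)"
proof -
  have w: "set_integrable lborel {0..1} w" and wl: "set_integrable lborel {0..1} (\<lambda>t. w t * ln (w t))"
    and pos: "AE t in lborel. t \<in> {0..1} \<longrightarrow> 0 < w t"
    using adm by (auto simp: admissible_def weight01_def)
  define u where "u t = indicator {0..1} t * w t" for t
  have [measurable]: "u \<in> borel_measurable borel"
    using borel_measurable_integrable[OF w[unfolded set_integrable_def]] by (simp add: u_def[abs_def])
  have ind: "indicator {0..1} t *\<^sub>R w t = u t"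
    "indicator {0..1} t *\<^sub>R (w t * ln (w t)) = u t * ln (u t)" for t
    by (auto simp: u_def split: split_indicator)
  have ui: "integrable lborel u" and uli: "integrable lborel (\<lambda>t. u t * ln (u t))"
    using w wl unfolding set_integrable_def ind by simp_all
  have AE_pos: "AE t in lborel. 0 < u t \<or> t \<notin> {0..1} \<and> u t = 0"
    using pos by eventually_elim (auto simp: u_def indicator_def)
  define T where "T t = u t powr (1 + \<epsilon>) * (if \<gamma> * u t \<le> b then 1 else 0)" for t
  have T_eq: "indicator {0..1} t *\<^sub>R (w t powr (1 + \<epsilon>) * (if \<gamma> * w t \<le> b then 1 else 0)) = T t" for t
    by (auto simp: T_def u_def split: split_indicator)
  have Ti: "integrable lborel T"
  proof (rule Bochner_Integration.integrable_bound)
    show "integrable lborel (\<lambda>t. indicator {0..1::real} t * (b / \<gamma>) powr (1 + \<epsilon>))" by simp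
    show "T \<in> borel_measurable lborel" unfolding T_def by simp
    show "AE t in lborel. norm (T t) \<le> norm (indicator {0..1::real} t * (b / \<gamma>) powr (1 + \<epsilon>))"
      using AE_pos
    proof eventually_elim
      case (elim t)
      show ?case
      proof (cases "t \<in> {0..1} \<and> \<gamma> * u t \<le> b")
        case True
        then have "u t powr (1 + \<epsilon>) \<le> (b / \<gamma>) powr (1 + \<epsilon>)"
          using elim gamma_gt_1 eps_pos by (intro powr_mono2) (auto simp: field_simps)
        with True show ?thesis by (simp add: T_def)
      qed (auto simp: T_def u_def indicator_def)
    qed
  qed
  then show "set_integrable lborel {0..1} (\<lambda>t. w t powr (1 + \<epsilon>) * (if \<gamma> * w t \<le> b then 1 else 0))"
    unfolding set_integrable_def T_eq .
  \<comment> \<open>The kernel is restricted to the region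
    \<open>a \<le> L \<le> min b (\<gamma> w(t))\<close>. For fixed \<open>L\<close> its section is
    the superlevel integral; for fixed \<open>t\<close> it is the integral of
    \<open>truncated_kernel_lower_bound\<close>.\<close>
  define F where "F t L = (if L \<le> \<gamma> * u t then 1 else 0) *
      (indicator {a..b} L * (defect Q L (u t) * L powr (\<epsilon> - 1)))" for t L
  have meas [measurable]: "(\<lambda>(t, L). F t L) \<in> borel_measurable (lborel \<Otimes>\<^sub>M lborel)"
    unfolding F_def defect_def by measurable
  have cont: "integrable lborel (\<lambda>L. indicator {a..b} L * g L)" if "continuous_on {a..b} g" for g :: "real \<Rightarrow> real"
    using borel_integrable_atLeastAtMost'[OF that] by (simp add: set_integrable_def)
  have Fi: "integrable (lborel \<Otimes>\<^sub>M lborel) (\<lambda>(t, L). F t L)"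
  proof (rule Bochner_Integration.integrable_bound[OF _ meas])
    let ?p = "\<lambda>L. indicator {a..b} L * L powr (\<epsilon> - 1)"
    let ?q = "\<lambda>L. indicator {a..b} L * ((ln L + (1 + Q)) * L powr (\<epsilon> - 1))"
    let ?r = "\<lambda>L. indicator {a..b} L * (L * L powr (\<epsilon> - 1))"
    \<comment> \<open>Splitting the defect into products of a function of \<open>t\<close> and a
      function of \<open>L\<close> gives an integrable majorant on the product space, as Fubini
      requires.\<close>
    let ?B = "\<lambda>z. (case z of (t, L) \<Rightarrow> (u t * ln (u t)) * ?p L) - (case z of (t, L) \<Rightarrow> u t * ?q L)
        + (case z of (t, L) \<Rightarrow> indicator {0..1} t * ?r L)"
    show "integrable (lborel \<Otimes>\<^sub>M lborel) ?B"
      using a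
      by (intro Bochner_Integration.integrable_add Bochner_Integration.integrable_diff
          integrable_pair_mult ui uli cont) (auto intro!: continuous_intros)
    have "norm (F t L) \<le> norm (?B (t, L))" for t L
    proof (cases "t \<in> {0..1} \<and> L \<in> {a..b}")
      case True
      then have "?B (t, L) = defect Q L (u t) * L powr (\<epsilon> - 1)"
        by (simp add: defect_def algebra_simps)
      with True show ?thesis by (simp add: F_def)
    next
      case False
      then have "F t L = 0" using a by (auto simp: F_def u_def)
      then show ?thesis by simp
    qed
    then show "AE z in lborel \<Otimes>\<^sub>M lborel. norm (case z of (t, L) \<Rightarrow> F t L) \<le> norm (?B z)"
      by (auto simp: split_beta)
  qed
  have "(LINT t|lborel. F t L) \<le> 0" for L
  proof (cases "L \<in> {a..b}")
    case True
    then have L: "0 < L" "x \<le> L" using a by auto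
    have "(LINT t|lborel. F t L) =
        L powr (\<epsilon> - 1) * (LINT t:{t \<in> {0..1}. L \<le> \<gamma> * w t}|lborel. defect Q L (w t))"
      unfolding set_lebesgue_integral_def
      by (subst integral_mult_right_zero[symmetric], intro Bochner_Integration.integral_cong)
        (use True L in \<open>auto simp: F_def u_def split: split_indicator\<close>)
    also have "\<dots> \<le> 0"
      using integral_defect_superlevel_nonpos[OF adm gamma_root _ L] gamma_gt_1
      by (intro mult_nonneg_nonpos) auto
    finally show ?thesis .
  qed (simp add: F_def)
  \<comment> \<open>Each level section is nonpositive because \<open>L \<ge> a \<ge> x\<close>;
    changing the order of integration carries the sign over to the sections in
    \<open>t\<close>.\<close>
  then have "0 \<le> (LINT L|lborel. - (LINT t|lborel. F t L))"
    by (intro integral_nonneg_AE) auto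
  then have "(LINT L|lborel. (LINT t|lborel. F t L)) \<le> 0" by simp
  then have nonpos: "(LINT t|lborel. (LINT L|lborel. F t L)) \<le> 0"
    using lborel_pair.Fubini_integral[OF Fi] by simp
  define P where "P t = indicator {0..1} t * defect_prim \<epsilon> Q (w t) a" for t
  have P_eq: "P t = a powr \<epsilon> * (u t * ln (u t) / \<epsilon> + u t * (1 / \<epsilon>\<^sup>2 - ln a / \<epsilon> - (1 + Q) / \<epsilon>)
      + indicator {0..1} t * (a / (1 + \<epsilon>)))" for t
    by (auto simp: P_def u_def defect_prim_def algebra_simps diff_divide_distrib add_divide_distrib
        split: split_indicator)
  have Pi: "integrable lborel P"
    unfolding P_eq using ui uli by simp
  have "(LINT t|lborel. moment_const * T t - P t) \<le> (LINT t|lborel. (LINT L|lborel. F t L))"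
  proof (rule integral_mono_AE)
    show "integrable lborel (\<lambda>t. moment_const * T t - P t)" using Ti Pi by simp
    show "integrable lborel (\<lambda>t. LINT L|lborel. F t L)" using lborel_pair.integrable_fst[OF Fi] by simp
    show "AE t in lborel. moment_const * T t - P t \<le> (LINT L|lborel. F t L)"
      using AE_pos
    proof eventually_elim
      case (elim t)
      show ?case
      proof (cases "t \<in> {0..1}")
        case True
        with elim have ut: "0 < u t" and uw: "u t = w t" by (auto simp: u_def)
        have "(LINT L|lborel. F t L) =
            (LINT L:{a..min b (\<gamma> * u t)}|lborel. defect Q L (u t) * L powr (\<epsilon> - 1))"
          unfolding set_lebesgue_integral_def F_def
          by (auto intro!: Bochner_Integration.integral_cong split: split_indicator)
        then show ?thesis
          using truncated_kernel_lower_bound[OF ut a(1,3)] True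
          by (simp add: T_def P_def uw mult.assoc)
      next
        case False
        then have "F t L = 0" for L using a by (auto simp: F_def u_def)
        then show ?thesis using False by (simp add: T_def P_def u_def)
      qed
    qed
  qed
  with nonpos have "moment_const * (LINT t|lborel. T t) \<le> (LINT t|lborel. P t)"
    using Ti Pi by simp
  then show "moment_const * (LINT t:{0..1}|lborel. w t powr (1 + \<epsilon>) * (if \<gamma> * w t \<le> b then 1 else 0))
      \<le> (LINT t:{0..1}|lborel. defect_prim \<epsilon> Q (w t) a)"
    unfolding set_lebesgue_integral_def T_eq by (simp add: P_def)
qed

definition bellman_value :: "real \<Rightarrow> real \<Rightarrow> real" where
  "bellman_value x v = v powr \<epsilon> / (1 + \<epsilon> - \<gamma> * \<epsilon>) * (x * (1 + \<epsilon>) - \<epsilon> * \<gamma> * v)"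

text \<open>At the fixed level \<open>\<gamma> v\<close> the primitive is affine in \<open>w\<close>
  and \<open>w ln w\<close>, so its integral depends on \<open>x\<close> and \<open>y\<close> only.
  Eliminating \<open>y\<close> by the equation for \<open>v\<close> produces the claimed
  value.\<close>

lemma integral_defect_prim:
  assumes adm: "admissible Q x y w" and v: "0 < v" "y = (ln v + \<gamma>) * x - v * \<gamma>"
  shows "(LINT t:{0..1}|lborel. defect_prim \<epsilon> Q (w t) (\<gamma> * v)) = moment_const * bellman_value x v"
proof -
  have w: "set_integrable lborel {0..1} w" and wl: "set_integrable lborel {0..1} (\<lambda>t. w t * ln (w t))"
    and x: "(LINT t:{0..1}|lborel. w t) = x" and y: "(LINT t:{0..1}|lborel. w t * ln (w t)) = y"
    using adm by (auto simp: admissible_def weight01_def avg_def)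
  define k where "k = 1 / \<epsilon>\<^sup>2 - ln (\<gamma> * v) / \<epsilon> - (1 + Q) / \<epsilon>"
  have eq: "defect_prim \<epsilon> Q (w t) (\<gamma> * v) = (\<gamma> * v) powr \<epsilon> * (w t * ln (w t) / \<epsilon> + w t * k + \<gamma> * v / (1 + \<epsilon>))" for t
    by (simp add: defect_prim_def k_def algebra_simps diff_divide_distrib add_divide_distrib)
  have c: "set_integrable lborel {0..1::real} (\<lambda>t. \<gamma> * v / (1 + \<epsilon>))"
    by (rule borel_integrable_atLeastAtMost') simp
  have wl': "set_integrable lborel {0..1} (\<lambda>t. w t * ln (w t) / \<epsilon>)"
    and w': "set_integrable lborel {0..1} (\<lambda>t. w t * k)"
    using w wl by simp_all
  have "(LINT t:{0..1::real}|lborel. \<gamma> * v / (1 + \<epsilon>)) = \<gamma> * v / (1 + \<epsilon>)"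
    by (simp add: set_lebesgue_integral_def)
  then have "(LINT t:{0..1}|lborel. defect_prim \<epsilon> Q (w t) (\<gamma> * v)) =
      (\<gamma> * v) powr \<epsilon> * (y / \<epsilon> + x * k + \<gamma> * v / (1 + \<epsilon>))"
    unfolding eq using w' wl' c x y by (simp add: set_integral_add)
  also have "k = 1 / \<epsilon>\<^sup>2 - (\<gamma> + ln v) / \<epsilon>"
  proof -
    have "ln (\<gamma> * v) + (1 + Q) = \<gamma> + ln v"
      using v gamma_gt_1 gamma_root by (simp add: ln_mult)
    then show ?thesis by (simp add: k_def diff_divide_distrib[symmetric] add_divide_distrib[symmetric] diff_diff_add)
  qed
  also have "y / \<epsilon> + x * (1 / \<epsilon>\<^sup>2 - (\<gamma> + ln v) / \<epsilon>) + \<gamma> * v / (1 + \<epsilon>) =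
      (x * (1 + \<epsilon>) - \<epsilon> * \<gamma> * v) / (\<epsilon>\<^sup>2 * (1 + \<epsilon>))"
  proof -
    have "1 + \<epsilon> \<noteq> 0" "\<epsilon> \<noteq> 0" using eps_pos by auto
    then show ?thesis unfolding v(2)
      by (simp add: divide_simps) (simp add: power2_eq_square algebra_simps)
  qed
  finally show ?thesis
    using v gamma_gt_1 denom_pos by (simp add: bellman_value_def moment_const_def powr_mult)
qed

text \<open>The truncated bound is used from the level \<open>\<gamma> v \<ge> x\<close> upwards.
  Its right-hand side does not depend on the cut-off, which is removed by monotone
  convergence.\<close>

theorem pow_avg_le_bellman_value:
  assumes adm: "admissible Q x y w" and v: "0 < v" "x \<le> \<gamma> * v" "y = (ln v + \<gamma>) * x - v * \<gamma>"
  shows "pow_avg \<epsilon> w \<le> ereal (bellman_value x v)"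
proof -
  let ?B = "bellman_value x v"
  \<comment> \<open>The cut-off starts at \<open>\<gamma> v\<close> itself, so the level range is
    nonempty already for \<open>n = 0\<close>.\<close>
  define T where "T n t = w t powr (1 + \<epsilon>) * (if \<gamma> * w t \<le> \<gamma> * v + real n then 1 else 0)" for n t
  have av: "0 < \<gamma> * v" using v gamma_gt_1 by simp
  have Ti: "set_integrable lborel {0..1} (T n)" and
    Tle: "(LINT t:{0..1}|lborel. T n t) \<le> ?B" for n
  proof -
    show "set_integrable lborel {0..1} (T n)"
      unfolding T_def using av v by (intro truncated_moment_bound(1)[OF adm, of "\<gamma> * v"]) auto
    have "moment_const * (LINT t:{0..1}|lborel. T n t) \<le> moment_const * ?B"
      unfolding T_def integral_defect_prim[OF adm v(1,3), symmetric]
      using av v by (intro truncated_moment_bound(2)[OF adm]) auto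
    then show "(LINT t:{0..1}|lborel. T n t) \<le> ?B" using moment_const_pos by simp
  qed
  have Tnn: "0 \<le> T n t" for n t by (simp add: T_def)
  have "0 \<le> (LINT t:{0..1}|lborel. T 0 t)"
    unfolding set_lebesgue_integral_def using Tnn by (intro integral_nonneg_AE) auto
  then have Bnn: "0 \<le> ?B" using Tle[of 0] by simp
  have nn_le: "(\<integral>\<^sup>+t\<in>{0..1}. ennreal (T n t) \<partial>lborel) \<le> ennreal ?B" for n
  proof -
    have "(\<integral>\<^sup>+t\<in>{0..1}. ennreal (T n t) \<partial>lborel) = (\<integral>\<^sup>+t. ennreal (indicator {0..1} t *\<^sub>R T n t) \<partial>lborel)"
      by (auto intro!: nn_integral_cong split: split_indicator)
    also have "\<dots> = ennreal (LINT t:{0..1}|lborel. T n t)"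
      unfolding set_lebesgue_integral_def using Ti[of n] Tnn
      by (intro nn_integral_eq_integral) (auto simp: set_integrable_def)
    also have "\<dots> \<le> ennreal ?B" using Tle by (rule ennreal_leI)
    finally show ?thesis .
  qed
  have "(\<integral>\<^sup>+t\<in>{0..1}. ennreal (w t powr (1 + \<epsilon>)) \<partial>lborel) \<le>
      (\<integral>\<^sup>+t. (SUP n. ennreal (T n t) * indicator {0..1} t) \<partial>lborel)"
  proof (rule nn_integral_mono)
    fix t
    obtain n where "\<gamma> * w t - \<gamma> * v \<le> real n" using real_arch_simple by blast
    then have "T n t = w t powr (1 + \<epsilon>)" by (simp add: T_def)
    then show "ennreal (w t powr (1 + \<epsilon>)) * indicator {0..1} t \<le> (SUP n. ennreal (T n t) * indicator {0..1} t)"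
      by (intro SUP_upper2[of n]) auto
  qed
  also have "\<dots> = (SUP n. (\<integral>\<^sup>+t\<in>{0..1}. ennreal (T n t) \<partial>lborel))"
  proof (rule nn_integral_monotone_convergence_SUP)
    show "incseq (\<lambda>n t. ennreal (T n t) * indicator {0..1} t)"
      by (auto simp: incseq_def le_fun_def T_def intro!: mult_right_mono ennreal_leI)
    show "(\<lambda>t. ennreal (T n t) * indicator {0..1} t) \<in> borel_measurable lborel" for n
    proof -
      have "(\<lambda>t. ennreal (indicator {0..1} t *\<^sub>R T n t)) \<in> borel_measurable lborel"
        using Ti[of n] unfolding set_integrable_def by (auto dest: borel_measurable_integrable)
      also have "(\<lambda>t. ennreal (indicator {0..1} t *\<^sub>R T n t)) = (\<lambda>t. ennreal (T n t) * indicator {0..1} t)"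
        by (auto split: split_indicator)
      finally show ?thesis .
    qed
  qed
  also have "\<dots> \<le> ennreal ?B" using nn_le by (rule SUP_least)
  finally show ?thesis
    unfolding pow_avg_def using enn2ereal_ennreal[OF Bnn] less_eq_ennreal.rep_eq by metis
qed

end

section \<open>Extremal weights\<close>

text \<open>The gauge integral admits a finite exceptional set and an integrand unbounded near an
  end point, as powers are at 0. The lower bound \<open>m\<close> makes \<open>f - m\<close>
  nonnegative and so turns gauge integrability into Lebesgue integrability.\<close>

lemma FTC_lborel_bounded_below:
  fixes f F :: "real \<Rightarrow> real"
  assumes [measurable]: "f \<in> borel_measurable borel" and "finite S" "p \<le> q"
    and deriv: "\<And>t. t \<in> {p<..<q} - S \<Longrightarrow> (F has_real_derivative f t) (at t)"
    and cont: "continuous_on {p..q} F" and below: "\<And>t. t \<in> {p..q} \<Longrightarrow> m \<le> f t"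
  shows "set_integrable lborel {p..q} f" "(LINT t:{p..q}|lborel. f t) = F q - F p"
proof -
  have hk: "(f has_integral F q - F p) {p..q}"
    using assms by (intro fundamental_theorem_of_calculus_interior_strong[of S])
      (auto simp: has_real_derivative_iff_has_vector_derivative)
  then have "(\<lambda>t. f t - m) integrable_on {p..q}"
    by (intro integrable_diff) auto
  then have "(\<lambda>t. f t - m) absolutely_integrable_on {p..q}"
    by (rule nonnegative_absolutely_integrable_1) (use below in auto)
  then have "set_integrable lborel {p..q} (\<lambda>t. f t - m)"
    unfolding set_integrable_def by (subst (asm) integrable_completion) auto
  moreover have "set_integrable lborel {p..q} (\<lambda>t. m)"
    by (rule borel_integrable_atLeastAtMost') simp
  ultimately have "set_integrable lborel {p..q} (\<lambda>t. (f t - m) + m)"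
    by (intro set_integral_add)
  then show i: "set_integrable lborel {p..q} f" by simp
  show "(LINT t:{p..q}|lborel. f t) = F q - F p"
    using set_borel_integral_eq_integral(2)[OF i] hk by (simp add: integral_unique)
qed

lemma diff_one_le_mult_ln: "0 < z \<Longrightarrow> z - 1 \<le> z * ln z" for z :: real
  using ln_le_minus_one[of "1 / z"] by (simp add: ln_div field_simps)

text \<open>Only the point 0 is delicate. There half of the power absorbs the logarithm, since
  \<open>- z ln z \<le> 1\<close> for \<open>z = t powr (\<delta> / 2)\<close>, and the other half
  tends to 0.\<close>

lemma continuous_on_powr_mult_ln:
  fixes \<delta> :: real
  assumes "0 < \<delta>"
  shows "continuous_on {0..} (\<lambda>t. t powr \<delta> * ln t)"
  unfolding continuous_on_eq_continuous_within
proof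
  fix t :: real assume "t \<in> {0..}"
  show "continuous (at t within {0..}) (\<lambda>t. t powr \<delta> * ln t)"
  proof (cases "t = 0")
    case True
    have bound: "norm (r powr \<delta> * ln r) \<le> 2 / \<delta> * r powr (\<delta> / 2)" if r: "0 \<le> r" "r < 1" for r
    proof (cases "r = 0")
      case False
      define z where "z = r powr (\<delta> / 2)"
      have z: "0 < z" using r False by (simp add: z_def)
      have "ln z = \<delta> / 2 * ln r" using r False by (simp add: z_def ln_powr)
      then have lnr: "ln r = 2 / \<delta> * ln z" using assms by (simp add: field_simps)
      have "r powr \<delta> = z * z" by (simp add: z_def powr_add[symmetric])
      then have "- (r powr \<delta> * ln r) = 2 / \<delta> * z * (- (z * ln z))" by (simp add: lnr)
      also have "\<dots> \<le> 2 / \<delta> * z * 1"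
        using assms z diff_one_le_mult_ln[OF z] by (intro mult_left_mono) auto
      finally show ?thesis using r False by (simp add: z_def abs_mult)
    qed simp
    have "continuous_on {0..} (\<lambda>r. 2 / \<delta> * r powr (\<delta> / 2))"
      using assms by (intro continuous_on_mult continuous_on_powr' continuous_on_const continuous_on_id) auto
    from this[unfolded continuous_on_def, rule_format, of 0]
    have "((\<lambda>r. 2 / \<delta> * r powr (\<delta> / 2)) \<longlongrightarrow> 0) (at 0 within {0..})" by simp
    moreover have "\<forall>\<^sub>F r in at 0 within {0..}. norm (r powr \<delta> * ln r) \<le> 2 / \<delta> * r powr (\<delta> / 2)"
      unfolding eventually_at using bound by (intro exI[of _ 1]) (auto simp: dist_real_def)
    ultimately have "((\<lambda>r. r powr \<delta> * ln r) \<longlongrightarrow> 0) (at 0 within {0..})"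
      by (rule Lim_null_comparison[rotated])
    with True show ?thesis by (simp add: continuous_within)
  next
    case False
    with \<open>t \<in> {0..}\<close> have "isCont (\<lambda>t. t powr \<delta> * ln t) t"
      by (auto intro!: continuous_intros)
    then show ?thesis by (rule continuous_at_imp_continuous_at_within)
  qed
qed

section \<open>Truncated powers and their primitives\<close>

context rh1_params
begin

abbreviation \<beta> :: real where "\<beta> \<equiv> (1 - \<gamma>) / \<gamma>"

text \<open>The case \<open>a = 0\<close> is set apart because \<open>0 powr \<beta> = 0\<close>
  would turn the plateau into 0; it stands for the constant weight \<open>C\<close>.\<close>

definition extremal :: "real \<Rightarrow> real \<Rightarrow> real \<Rightarrow> real" where
  "extremal C a t = (if a = 0 then C else if t \<le> a then C * t powr \<beta> else C * a powr \<beta>)"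

definition plateau :: "real \<Rightarrow> real \<Rightarrow> real" where
  "plateau C a = (if a = 0 then C else C * a powr \<beta>)"

text \<open>A continuous primitive for a truncated power: \<open>H\<close> on the power part,
  continued with the constant slope \<open>k\<close> on the plateau.\<close>

definition glue :: "real \<Rightarrow> (real \<Rightarrow> real) \<Rightarrow> real \<Rightarrow> real \<Rightarrow> real" where
  "glue a H k t = (if t \<le> a then H t else H a + k * (t - a))"

lemma plateau_pos: "0 < C \<Longrightarrow> 0 \<le> a \<Longrightarrow> 0 < plateau C a"
  by (simp add: plateau_def)

lemma extremal_measurable [measurable]: "extremal C a \<in> borel_measurable borel"
  unfolding extremal_def[abs_def] by measurable

lemma extremal_pos: "0 < C \<Longrightarrow> 0 < t \<Longrightarrow> 0 \<le> a \<Longrightarrow> 0 < extremal C a t"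
  by (simp add: extremal_def)

lemma extremal_nonneg: "0 < C \<Longrightarrow> 0 \<le> extremal C a t"
  by (simp add: extremal_def)

text \<open>One computation serves mass, entropy and power moment. The glued primitive is continuous
  and has the right derivative except at the junction \<open>a\<close>; the lower bound on
  \<open>\<phi>\<close> gives integrability near 0.\<close>

lemma integral_comp_extremal:
  assumes C: "0 < C" and a: "0 \<le> a" "a \<le> 1" and [measurable]: "\<phi> \<in> borel_measurable borel"
    and below: "\<And>s. 0 \<le> s \<Longrightarrow> m \<le> \<phi> s"
    and H: "continuous_on {0..} H" "\<And>t. 0 < t \<Longrightarrow> (H has_real_derivative \<phi> (C * t powr \<beta>)) (at t)"
    and pq: "0 \<le> p" "p \<le> q"
  shows "set_integrable lborel {p..q} (\<lambda>t. \<phi> (extremal C a t))"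
    and "(LINT t:{p..q}|lborel. \<phi> (extremal C a t)) =
      glue a H (\<phi> (plateau C a)) q - glue a H (\<phi> (plateau C a)) p"
proof -
  let ?F = "glue a H (\<phi> (plateau C a))"
  have cont: "continuous_on {p..q} ?F"
  proof -
    have "continuous_on ({0..a} \<union> {a..}) ?F"
      unfolding glue_def[abs_def]
    proof (rule continuous_on_If)
      show "continuous_on {0..a} H" by (rule continuous_on_subset[OF H(1)]) auto
    qed (auto intro!: continuous_intros)
    then show ?thesis by (rule continuous_on_subset) (use pq in auto)
  qed
  have deriv: "(?F has_real_derivative \<phi> (extremal C a t)) (at t)" if t: "t \<in> {p<..<q} - {a}" for t
  proof (cases "t < a")
    case True
    then have "\<forall>\<^sub>F s in nhds t. ?F s = H s"
      using eventually_nhds_in_open[of "{..<a}" t] by (auto elim!: eventually_mono simp: glue_def)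
    moreover have "(H has_real_derivative \<phi> (extremal C a t)) (at t)"
      using H(2)[of t] True t pq by (simp add: extremal_def)
    ultimately show ?thesis by (simp add: DERIV_cong_ev)
  next
    case False
    then have "a < t" using t by auto
    then have "\<forall>\<^sub>F s in nhds t. ?F s = H a + \<phi> (plateau C a) * (s - a)"
      using eventually_nhds_in_open[of "{a<..}" t] by (auto elim!: eventually_mono simp: glue_def)
    moreover have "((\<lambda>s. H a + \<phi> (plateau C a) * (s - a)) has_real_derivative \<phi> (extremal C a t)) (at t)"
      using \<open>a < t\<close> by (auto intro!: derivative_eq_intros simp: extremal_def plateau_def)
    ultimately show ?thesis by (simp add: DERIV_cong_ev)
  qed
  have "(\<lambda>t. \<phi> (extremal C a t)) \<in> borel_measurable borel" by measurable
  then show "set_integrable lborel {p..q} (\<lambda>t. \<phi> (extremal C a t))"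
    and "(LINT t:{p..q}|lborel. \<phi> (extremal C a t)) = ?F q - ?F p"
    using FTC_lborel_bounded_below[where m = m and S = "{a}", OF _ _ pq(2) deriv cont]
      below extremal_nonneg[OF C] by auto
qed

definition mass_prim :: "real \<Rightarrow> real \<Rightarrow> real" where
  "mass_prim C t = \<gamma> * C * t powr (1 / \<gamma>)"

definition entropy_prim :: "real \<Rightarrow> real \<Rightarrow> real" where
  "entropy_prim C t =
     \<gamma> * C * ((ln C + \<gamma> - 1) * t powr (1 / \<gamma>) + \<beta> * (t powr (1 / \<gamma>) * ln t))"

definition power_prim :: "real \<Rightarrow> real \<Rightarrow> real" where
  "power_prim C t = C powr (1 + \<epsilon>) * t powr (1 + \<beta> * (1 + \<epsilon>)) / (1 + \<beta> * (1 + \<epsilon>))"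

lemma beta_eq: "1 / \<gamma> - 1 = \<beta>" "1 + \<beta> = 1 / \<gamma>"
  using gamma_gt_1 by (simp_all add: field_simps)

text \<open>By the bound on \<open>\<epsilon>\<close> this exponent is positive, which is what makes
  \<open>w powr (1 + \<epsilon>)\<close> integrable at 0.\<close>

lemma power_exponent: "1 + \<beta> * (1 + \<epsilon>) = (1 + \<epsilon> - \<gamma> * \<epsilon>) / \<gamma>"
  using gamma_gt_1 by (simp add: field_simps)

lemma continuous_prims:
  "continuous_on {0..} (mass_prim C)" "continuous_on {0..} (entropy_prim C)"
  "continuous_on {0..} (power_prim C)"
proof -
  have p: "continuous_on {0..} (\<lambda>t::real. t powr d)" if "0 < d" for d
    using that by (intro continuous_on_powr' continuous_intros) auto
  have g: "0 < 1 / \<gamma>" using gamma_gt_1 by simp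
  have e: "0 < 1 + \<beta> * (1 + \<epsilon>)" unfolding power_exponent using denom_pos gamma_gt_1 by simp
  show "continuous_on {0..} (mass_prim C)"
    unfolding mass_prim_def[abs_def] by (intro continuous_intros p[OF g])
  show "continuous_on {0..} (entropy_prim C)"
    unfolding entropy_prim_def[abs_def]
    by (intro continuous_on_mult continuous_on_add continuous_on_const p[OF g] continuous_on_powr_mult_ln[OF g])
  have "continuous_on {0..} (\<lambda>t. C powr (1 + \<epsilon>) / (1 + \<beta> * (1 + \<epsilon>)) * t powr (1 + \<beta> * (1 + \<epsilon>)))"
    by (intro continuous_on_mult continuous_on_const p[OF e])
  then show "continuous_on {0..} (power_prim C)"
    by (simp add: power_prim_def[abs_def])
qed

lemma DERIV_mass_prim:
  assumes "0 < t" shows "(mass_prim C has_real_derivative C * t powr \<beta>) (at t)"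
proof -
  have "(mass_prim C has_real_derivative \<gamma> * C * (1 / \<gamma> * t powr (1 / \<gamma> - 1))) (at t)"
    unfolding mass_prim_def[abs_def] by (intro DERIV_cmult has_real_derivative_powr assms)
  then show ?thesis using gamma_gt_1 by (simp only: beta_eq) simp
qed

lemma DERIV_entropy_prim:
  assumes "0 < t" "0 < C"
  shows "(entropy_prim C has_real_derivative C * t powr \<beta> * ln (C * t powr \<beta>)) (at t)"
proof -
  have pw: "((\<lambda>t. t powr (1 / \<gamma>)) has_real_derivative 1 / \<gamma> * t powr \<beta>) (at t)"
    using has_real_derivative_powr[OF assms(1), of "1 / \<gamma>"] by (simp only: beta_eq)
  have tp: "t powr (1 / \<gamma>) = t * t powr \<beta>"
    using assms by (simp add: beta_eq(2)[symmetric] powr_add)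
  have "(entropy_prim C has_real_derivative
      \<gamma> * C * ((ln C + \<gamma> - 1) * (1 / \<gamma> * t powr \<beta>)
        + \<beta> * (1 / \<gamma> * t powr \<beta> * ln t + 1 / t * t powr (1 / \<gamma>)))) (at t)"
    unfolding entropy_prim_def[abs_def]
    by (intro DERIV_cmult DERIV_add DERIV_mult pw DERIV_ln_divide assms)
  also have "\<gamma> * C * ((ln C + \<gamma> - 1) * (1 / \<gamma> * t powr \<beta>)
        + \<beta> * (1 / \<gamma> * t powr \<beta> * ln t + 1 / t * t powr (1 / \<gamma>)))
      = C * t powr \<beta> * (\<gamma> * (1 / \<gamma>) * (ln C + \<gamma> - 1) + \<gamma> * (1 / \<gamma>) * \<beta> * ln t + \<gamma> * \<beta>)"
  proof -
    have "1 / t * (t * t powr \<beta>) = t powr \<beta>" using assms(1) by simp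
    moreover have "\<gamma> * C * (k * (i * T) + b * (i * T * l + T)) = C * T * (\<gamma> * i * k + \<gamma> * i * b * l + \<gamma> * b)"
      for k i T b l by (simp add: algebra_simps)
    ultimately show ?thesis unfolding tp by (simp only:)
  qed
  \<comment> \<open>The summand \<open>\<gamma> - 1\<close> in \<open>entropy_prim\<close> is there
    to cancel \<open>\<gamma> * \<beta> = 1 - \<gamma>\<close>.\<close>
  also have "\<gamma> * (1 / \<gamma>) * (ln C + \<gamma> - 1) + \<gamma> * (1 / \<gamma>) * \<beta> * ln t + \<gamma> * \<beta> = ln C + \<beta> * ln t"
    using gamma_gt_1 by simp
  also have "\<dots> = ln (C * t powr \<beta>)" using assms by (simp add: ln_mult ln_powr)
  finally show ?thesis .
qed

lemma DERIV_power_prim: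
  assumes "0 < t" "0 < C"
  shows "(power_prim C has_real_derivative (C * t powr \<beta>) powr (1 + \<epsilon>)) (at t)"
proof -
  let ?e = "1 + \<beta> * (1 + \<epsilon>)"
  have e: "?e \<noteq> 0" unfolding power_exponent using denom_pos gamma_gt_1 by simp
  have "(power_prim C has_real_derivative C powr (1 + \<epsilon>) * (?e * t powr (?e - 1)) / ?e) (at t)"
    unfolding power_prim_def[abs_def] by (intro DERIV_cdivide DERIV_cmult has_real_derivative_powr assms)
  also have "C powr (1 + \<epsilon>) * (?e * t powr (?e - 1)) / ?e = C powr (1 + \<epsilon>) * t powr (\<beta> * (1 + \<epsilon>))"
    using e by simp
  also have "\<dots> = (C * t powr \<beta>) powr (1 + \<epsilon>)"
    using assms by (simp add: powr_mult powr_powr)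
  finally show ?thesis .
qed

lemma neg_one_le_mult_ln: "0 \<le> s \<Longrightarrow> - 1 \<le> s * ln s" for s :: real
  using diff_one_le_mult_ln[of s] by (cases "s = 0") auto

lemma extremal_integrals:
  assumes C: "0 < C" and a: "0 \<le> a" "a \<le> 1" and pq: "0 \<le> p" "p \<le> q"
  shows "set_integrable lborel {p..q} (extremal C a)"
    and "(LINT t:{p..q}|lborel. extremal C a t) =
      glue a (mass_prim C) (plateau C a) q - glue a (mass_prim C) (plateau C a) p"
    and "set_integrable lborel {p..q} (\<lambda>t. extremal C a t * ln (extremal C a t))"
    and "(LINT t:{p..q}|lborel. extremal C a t * ln (extremal C a t)) =
      glue a (entropy_prim C) (plateau C a * ln (plateau C a)) q
      - glue a (entropy_prim C) (plateau C a * ln (plateau C a)) p"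
    and "set_integrable lborel {p..q} (\<lambda>t. extremal C a t powr (1 + \<epsilon>))"
    and "(LINT t:{p..q}|lborel. extremal C a t powr (1 + \<epsilon>)) =
      glue a (power_prim C) (plateau C a powr (1 + \<epsilon>)) q - glue a (power_prim C) (plateau C a powr (1 + \<epsilon>)) p"
  using integral_comp_extremal[OF C a, of "\<lambda>s. s" 0 "mass_prim C", OF _ _ continuous_prims(1) DERIV_mass_prim pq]
    integral_comp_extremal[OF C a, of "\<lambda>s. s * ln s" "- 1" "entropy_prim C",
      OF _ neg_one_le_mult_ln continuous_prims(2) DERIV_entropy_prim[OF _ C] pq]
    integral_comp_extremal[OF C a, of "\<lambda>s. s powr (1 + \<epsilon>)" 0 "power_prim C",
      OF _ _ continuous_prims(3) DERIV_power_prim[OF _ C] pq]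
  by simp_all

section \<open>The \<open>RH\<^sub>1\<close> bound for truncated powers\<close>

definition defect_int :: "real \<Rightarrow> real \<Rightarrow> real \<Rightarrow> real \<Rightarrow> real" where
  "defect_int C a L t = glue a (entropy_prim C) (plateau C a * ln (plateau C a)) t
     - (ln L + (1 + Q)) * glue a (mass_prim C) (plateau C a) t + L * t"

text \<open>Both primitives are expressed by the value \<open>s = C * t powr \<beta>\<close> of the
  power at \<open>t\<close>; in particular its mean over \<open>[0, t]\<close> is
  \<open>\<gamma> s\<close>.\<close>

lemma prims_pos_eq:
  assumes "0 < t" "0 < C"
  shows "mass_prim C t = t * (\<gamma> * (C * t powr \<beta>))"
    and "entropy_prim C t = t * (\<gamma> * (C * t powr \<beta>)) * (ln (C * t powr \<beta>) + \<gamma> - 1)"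
proof -
  have tp: "t powr (1 / \<gamma>) = t * t powr \<beta>"
    using assms by (simp add: beta_eq(2)[symmetric] powr_add)
  show "mass_prim C t = t * (\<gamma> * (C * t powr \<beta>))" by (simp add: mass_prim_def tp)
  have "ln (C * t powr \<beta>) = ln C + \<beta> * ln t" using assms by (simp add: ln_mult ln_powr)
  moreover have "\<gamma> * C * ((c + \<gamma> - 1) * (t * T) + b * (t * T * l)) = t * (\<gamma> * (C * T)) * (c + b * l + \<gamma> - 1)"
    for c T b l by (simp add: algebra_simps)
  ultimately show "entropy_prim C t = t * (\<gamma> * (C * t powr \<beta>)) * (ln (C * t powr \<beta>) + \<gamma> - 1)"
    by (simp only: entropy_prim_def tp)
qed

lemma prims_0 [simp]: "mass_prim C 0 = 0" "entropy_prim C 0 = 0" "power_prim C 0 = 0"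
  by (simp_all add: mass_prim_def entropy_prim_def power_prim_def)

text \<open>
  On the power part the integral of the defect over \<open>[0, t]\<close> is \<open>t L (z ln z - z + 1)\<close> with
  \<open>z = \<gamma> w(t) / L\<close>: it is nonnegative and vanishes for \<open>L = \<gamma> w(t)\<close>. Hence with \<open>L = \<gamma> w(q)\<close>
  the integral over \<open>[p, q]\<close> is nonpositive.
\<close>

lemma defect_int_power:
  assumes "0 < t" "t \<le> a" "0 < C" "0 < L"
  shows "defect_int C a L t = t * L *
    ((\<gamma> * (C * t powr \<beta>) / L) * ln (\<gamma> * (C * t powr \<beta>) / L) - \<gamma> * (C * t powr \<beta>) / L + 1)"
proof -
  define s where "s = C * t powr \<beta>"
  have s: "0 < s" using assms by (simp add: s_def)
  have "ln s + \<gamma> - 1 - (ln L + (1 + Q)) = ln (\<gamma> * s / L) - 1"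
    using s assms gamma_gt_1 gamma_root by (simp add: ln_mult ln_div)
  then have "t * (\<gamma> * s) * (ln s + \<gamma> - 1) - (ln L + (1 + Q)) * (t * (\<gamma> * s)) + L * t
      = t * (\<gamma> * s) * (ln (\<gamma> * s / L) - 1) + L * t"
    by (metis (no_types, opaque_lifting) left_diff_distrib mult.commute)
  also have "\<dots> = t * L * (\<gamma> * s / L * ln (\<gamma> * s / L) - \<gamma> * s / L + 1)"
    using assms(4) by (simp add: algebra_simps)
  finally show ?thesis
    using assms by (simp add: defect_int_def glue_def prims_pos_eq s_def)
qed

lemma defect_int_nonneg:
  assumes "0 \<le> t" "t \<le> a" "0 < C" "0 < L"
  shows "0 \<le> defect_int C a L t"
proof (cases "t = 0")
  case False
  then have t: "0 < t" using assms by simp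
  let ?z = "\<gamma> * (C * t powr \<beta>) / L"
  have "0 \<le> ?z * ln ?z - ?z + 1"
    using diff_one_le_mult_ln[of ?z] assms t gamma_gt_1 by simp
  then show ?thesis using defect_int_power[OF t assms(2-4)] t assms by simp
qed (use assms in \<open>simp add: defect_int_def glue_def\<close>)

text \<open>At the level \<open>\<gamma> v\<close>, with \<open>v\<close> the plateau value, the
  integral over \<open>[0, a]\<close> vanishes because this level is the mean there, and the defect
  is zero on the plateau by the root equation.\<close>

lemma defect_int_plateau:
  assumes "0 \<le> a" "a \<le> t" "0 < C"
  shows "defect_int C a (\<gamma> * plateau C a) t = 0"
proof -
  let ?v = "plateau C a"
  have v: "0 < ?v" using assms by (simp add: plateau_pos)
  have "ln (\<gamma> * ?v) + (1 + Q) = ln ?v + \<gamma>"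
    using v gamma_gt_1 gamma_root by (simp add: ln_mult)
  then have k: "?v * ln ?v - (ln (\<gamma> * ?v) + (1 + Q)) * ?v + \<gamma> * ?v = 0" by (simp add: algebra_simps)
  have "defect_int C a (\<gamma> * ?v) a = 0"
  proof (cases "a = 0")
    case False
    then have "?v = C * a powr \<beta>" by (simp add: plateau_def)
    then show ?thesis
      using defect_int_power[of a a C "\<gamma> * ?v"] False assms v gamma_gt_1 by simp
  qed (simp add: defect_int_def glue_def)
  moreover have "defect_int C a (\<gamma> * ?v) t = defect_int C a (\<gamma> * ?v) a
      + (?v * ln ?v - (ln (\<gamma> * ?v) + (1 + Q)) * ?v + \<gamma> * ?v) * (t - a)"
    using assms by (cases "t = a") (simp_all add: defect_int_def glue_def algebra_simps)
  ultimately show ?thesis using k by simp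
qed

text \<open>For fixed mass and entropy the integral of the defect is convex in the level and
  smallest when the level is the mean. Nonpositivity at any single level therefore implies the
  \<open>RH\<^sub>1\<close> inequality, and the level \<open>\<gamma> w(q)\<close> is the convenient
  one.\<close>

lemma rh1_extremal:
  assumes C: "0 < C" and a: "0 \<le> a" "a \<le> 1"
  shows "rh1 (extremal C a) \<le> ereal Q"
  unfolding rh1_def
proof (rule Sup_least, clarify)
  fix p q :: real assume pq: "0 \<le> p" "p < q" "q \<le> 1"
  let ?w = "extremal C a" and ?m = "avg p q (extremal C a)"
  have w: "set_integrable lborel {p..q} ?w" and wl: "set_integrable lborel {p..q} (\<lambda>t. ?w t * ln (?w t))"
    using extremal_integrals[OF C a pq(1), of q] pq by auto
  have wq: "0 < ?w q" using extremal_pos[OF C _ a(1)] pq by simp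
  define L where "L = \<gamma> * ?w q"
  have L: "0 < L" using wq gamma_gt_1 by (simp add: L_def)
  have c: "(LINT t:{p..q}|lborel. L) = L * (q - p)"
    using pq by (simp add: set_lebesgue_integral_def)
  \<comment> \<open>\<open>defect_int C a L t\<close> is the integral of the defect over
    \<open>[0, t]\<close>.\<close>
  have "(LINT t:{p..q}|lborel. defect Q L (?w t)) = defect_int C a L q - defect_int C a L p"
    unfolding set_integrable_defect(2)[OF w wl] c defect_int_def
      extremal_integrals(2,4)[OF C a pq(1) less_imp_le[OF pq(2)]] by (simp add: algebra_simps)
  moreover have "defect_int C a L q = 0 \<and> 0 \<le> defect_int C a L p"
  proof (cases "q \<le> a")
    case True
    then have "?w q = C * q powr \<beta>" using pq by (simp add: extremal_def)
    then have "defect_int C a L q = 0"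
      using defect_int_power[of q a C L] True pq L C by (simp add: L_def)
    then show ?thesis using defect_int_nonneg[of p a C L] pq True C L by auto
  next
    case False
    then have "L = \<gamma> * plateau C a" using a by (simp add: L_def extremal_def plateau_def)
    then show ?thesis
      using defect_int_plateau[OF a(1) _ C, of q] defect_int_plateau[OF a(1) _ C, of p]
        defect_int_nonneg[of p a C L] False pq C L by (cases "p \<le> a") auto
  qed
  ultimately have neg: "(LINT t:{p..q}|lborel. defect Q L (?w t)) \<le> 0" by simp
  define A where "A = (LINT t:{p..q}|lborel. ?w t)"
  define Y where "Y = (LINT t:{p..q}|lborel. ?w t * ln (?w t))"
  have pos: "AE t in lborel. t \<in> {p..q} \<longrightarrow> 0 < ?w t"
    using AE_lborel_singleton[of 0] by eventually_elim (use extremal_pos[OF C _ a(1)] pq in auto)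
  have A: "0 < A"
  proof -
    have "0 \<le> A" unfolding A_def set_lebesgue_integral_def
      using extremal_nonneg[OF C] by (intro integral_nonneg_AE) auto
    moreover have "A \<noteq> 0"
    proof
      assume "A = 0"
      then have "AE t in lborel. indicator {p..q} t *\<^sub>R ?w t = 0"
        unfolding A_def set_lebesgue_integral_def using w extremal_nonneg[OF C]
        by (subst (asm) integral_nonneg_eq_0_iff_AE) (auto simp: set_integrable_def)
      with pos have "AE t in lborel. t \<notin> {p..q}"
        by eventually_elim (auto simp: indicator_def)
      then have "{p..q} \<in> null_sets lborel" by (subst AE_iff_null_sets) auto
      then have "emeasure lborel {p..q} = 0" by (rule null_setsD1)
      with pq show False by simp
    qed
    ultimately show ?thesis by simp
  qed
  define m where "m = A / (q - p)"
  have m: "0 < m" "m = avg p q ?w" using A pq by (auto simp: m_def avg_def A_def)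
  \<comment> \<open>This inequality is the passage from the level \<open>L\<close> to the mean
    \<open>m\<close>, using \<open>A / m = q - p\<close>.\<close>
  have "ln (L / m) \<le> L / m - 1" using L m by (intro ln_le_minus_one) auto
  then have "A * ln (L / m) \<le> A * (L / m - 1)" using A by (intro mult_left_mono) auto
  also have "\<dots> = L * (q - p) - A" using A pq by (simp add: m_def field_simps)
  finally have "A * (ln L - ln m) \<le> L * (q - p) - A" using L m by (simp add: ln_div)
  moreover have "Y - (ln L + (1 + Q)) * A + L * (q - p) \<le> 0"
    using neg unfolding set_integrable_defect(2)[OF w wl] c A_def Y_def .
  ultimately have "Y \<le> A * (ln m + Q)" by (simp add: algebra_simps)
  also have "\<dots> = (q - p) * m * (ln m + Q)" using pq by (simp add: m_def)
  finally have "Y / (q - p) / m - ln m \<le> Q" using m pq by (simp add: field_simps)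
  then show "ereal (avg p q (\<lambda>t. ?w t / ?m * ln (?w t / ?m))) \<le> ereal Q"
    using avg_normalized_entropy[OF w wl pos m pq(2)] by (simp add: m(2) avg_def Y_def)
qed

text \<open>The constant \<open>C\<close> makes the plateau value equal to \<open>v\<close>. The
  mean is then \<open>\<gamma> a v + (1 - a) v\<close>, and setting it equal to \<open>x\<close>
  gives \<open>a\<close>; the range \<open>v \<le> x \<le> \<gamma> v\<close> corresponds to
  \<open>0 \<le> a \<le> 1\<close>.\<close>

lemma extremal_averages:
  assumes v: "0 < v" "v \<le> x" "x \<le> \<gamma> * v" "y = (ln v + \<gamma>) * x - v * \<gamma>"
  defines "a \<equiv> (x / v - 1) / (\<gamma> - 1)"
  defines "C \<equiv> if a = 0 then v else v * a powr (- \<beta>)"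
  shows "0 < C" "0 \<le> a" "a \<le> 1" "admissible Q x y (extremal C a)"
    "pow_avg \<epsilon> (extremal C a) = ereal (bellman_value x v)"
proof -
  show a: "0 \<le> a" "a \<le> 1" using v gamma_gt_1 by (auto simp: a_def field_simps)
  show C: "0 < C" using v a by (simp add: C_def)
  have pl: "plateau C a = v"
    using a by (auto simp: plateau_def C_def powr_add[symmetric] mult.assoc)
  have x: "x = v * (1 + (\<gamma> - 1) * a)" using v gamma_gt_1 by (simp add: a_def)
  have q: "C * a powr \<beta> = v" if "a \<noteq> 0" using pl that by (simp add: plateau_def)
  have glue1: "glue a H k 1 = H a + k * (1 - a)" for H k using a by (auto simp: glue_def)
  have glue0: "glue a H k 0 = H 0" for H k using a by (auto simp: glue_def)
  have mass: "mass_prim C a = \<gamma> * a * v"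
    using prims_pos_eq(1)[of a C] q a C by (cases "a = 0") auto
  have entropy: "entropy_prim C a = \<gamma> * a * v * (ln v + \<gamma> - 1)"
    using prims_pos_eq(2)[of a C] q a C by (cases "a = 0") auto
  have power: "power_prim C a = a * v powr (1 + \<epsilon>) / ((1 + \<epsilon> - \<gamma> * \<epsilon>) / \<gamma>)"
  proof (cases "a = 0")
    case False
    then have "0 < a" using a by simp
    have "a powr (1 + \<beta> * (1 + \<epsilon>)) = a * (a powr \<beta>) powr (1 + \<epsilon>)"
      unfolding powr_powr powr_add[of a 1] using \<open>0 < a\<close> by simp
    then have "C powr (1 + \<epsilon>) * a powr (1 + \<beta> * (1 + \<epsilon>)) = a * (C powr (1 + \<epsilon>) * (a powr \<beta>) powr (1 + \<epsilon>))"
      by (simp only: mult.left_commute)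
    also have "\<dots> = a * (C * a powr \<beta>) powr (1 + \<epsilon>)"
      using \<open>0 < a\<close> C by (simp add: powr_mult)
    finally show ?thesis
      unfolding power_prim_def power_exponent[symmetric] using q False by simp
  qed simp
  note ints = extremal_integrals[OF C a, of 0 1, simplified]
  have avgx: "avg 0 1 (extremal C a) = x"
    using ints(2) mass x by (simp add: avg_def glue1 glue0 pl algebra_simps)
  have avgy: "avg 0 1 (\<lambda>t. extremal C a t * ln (extremal C a t)) = y"
  proof -
    have "avg 0 1 (\<lambda>t. extremal C a t * ln (extremal C a t)) =
        \<gamma> * a * v * (ln v + \<gamma> - 1) + v * ln v * (1 - a)"
      using ints(4) by (simp add: avg_def glue1 glue0 pl entropy)
    also have "\<dots> = y" unfolding v(4) x by (simp add: algebra_simps)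
    finally show ?thesis .
  qed
  have "AE t in lborel. t \<in> {0..1} \<longrightarrow> 0 < extremal C a t"
    using AE_lborel_singleton[of 0] by eventually_elim (use extremal_pos[OF C _ a(1)] in auto)
  then show "admissible Q x y (extremal C a)"
    using ints avgx avgy rh1_extremal[OF C a] by (simp add: admissible_def weight01_def)
  have "(\<integral>\<^sup>+t\<in>{0..1}. ennreal (extremal C a t powr (1 + \<epsilon>)) \<partial>lborel) =
      (\<integral>\<^sup>+t. ennreal (indicator {0..1} t *\<^sub>R (extremal C a t powr (1 + \<epsilon>))) \<partial>lborel)"
    by (auto intro!: nn_integral_cong split: split_indicator)
  also have "\<dots> = ennreal (LINT t:{0..1}|lborel. extremal C a t powr (1 + \<epsilon>))"
    unfolding set_lebesgue_integral_def using ints(5)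
    by (intro nn_integral_eq_integral) (auto simp: set_integrable_def)
  also have val: "(LINT t:{0..1}|lborel. extremal C a t powr (1 + \<epsilon>)) = bellman_value x v"
  proof -
    have "(LINT t:{0..1}|lborel. extremal C a t powr (1 + \<epsilon>)) =
        v powr (1 + \<epsilon>) * (a / ((1 + \<epsilon> - \<gamma> * \<epsilon>) / \<gamma>) + (1 - a))"
      using ints(6) by (simp add: glue1 glue0 pl power algebra_simps)
    also have "\<dots> = v powr \<epsilon> / (1 + \<epsilon> - \<gamma> * \<epsilon>) * (v * (\<gamma> * a + (1 - a) * (1 + \<epsilon> - \<gamma> * \<epsilon>)))"
    proof -
      have "1 + \<epsilon> - \<gamma> * \<epsilon> \<noteq> 0" using denom_pos by simp
      then have "a / ((1 + \<epsilon> - \<gamma> * \<epsilon>) / \<gamma>) + (1 - a) =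
          (\<gamma> * a + (1 - a) * (1 + \<epsilon> - \<gamma> * \<epsilon>)) / (1 + \<epsilon> - \<gamma> * \<epsilon>)"
        by (simp add: add_divide_distrib)
      then show ?thesis using v(1) by (simp add: powr_add)
    qed
    also have "v * (\<gamma> * a + (1 - a) * (1 + \<epsilon> - \<gamma> * \<epsilon>)) = x * (1 + \<epsilon>) - \<epsilon> * \<gamma> * v"
      unfolding x by (simp add: algebra_simps)
    finally show ?thesis by (simp add: bellman_value_def)
  qed
  finally have "(\<integral>\<^sup>+t\<in>{0..1}. ennreal (extremal C a t powr (1 + \<epsilon>)) \<partial>lborel) = ennreal (bellman_value x v)" .
  moreover have "0 \<le> bellman_value x v"
    unfolding val[symmetric] set_lebesgue_integral_def by (intro integral_nonneg_AE) auto
  ultimately show "pow_avg \<epsilon> (extremal C a) = ereal (bellman_value x v)"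
    by (simp add: pow_avg_def)
qed

text \<open>For fixed \<open>v\<close> the equation is the line tangent to the upper boundary at
  abscissa \<open>\<gamma> v\<close> and meeting the lower boundary at abscissa \<open>v\<close>.
  For fixed \<open>x\<close> its right-hand side decreases strictly in \<open>v\<close> from the
  upper boundary value at \<open>v = x / \<gamma>\<close> to the lower one at
  \<open>v = x\<close>.\<close>

lemma ex1_tangent_parameter:
  assumes x: "0 < x" and y: "x * ln x \<le> y" "y \<le> x * ln x + Q * x"
  shows "\<exists>!v. 0 < v \<and> v \<le> x \<and> x \<le> \<gamma> * v \<and> y = (ln v + \<gamma>) * x - v * \<gamma>"
proof -
  define f where "f v = (ln v + \<gamma>) * x - v * \<gamma>" for v
  have xg: "0 < x / \<gamma>" "x / \<gamma> \<le> x" using x gamma_gt_1 by (auto simp: field_simps)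
  have fx: "f x = x * ln x" by (simp add: f_def algebra_simps)
  have fxg: "f (x / \<gamma>) = x * ln x + Q * x"
  proof -
    have "f (x / \<gamma>) = x * (ln x + (\<gamma> - ln \<gamma>) - 1)"
      using x gamma_gt_1 by (simp add: f_def ln_div algebra_simps)
    then show ?thesis unfolding gamma_root by (simp add: algebra_simps)
  qed
  have "continuous_on {x / \<gamma>..x} f"
    unfolding f_def[abs_def] using xg by (intro continuous_intros) auto
  then obtain v where v: "x / \<gamma> \<le> v" "v \<le> x" "f v = y"
    using IVT2'[of f x y "x / \<gamma>"] y fx fxg xg by auto
  \<comment> \<open>The derivative of \<open>f\<close> at \<open>v\<close> is
    \<open>x / v - \<gamma>\<close>, nonpositive from \<open>x / \<gamma>\<close> on; the strict
    bound \<open>ln z < z - 1\<close> for \<open>z > 1\<close> gives strictness.\<close>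
  have strict: "f b < f a" if "0 < a" "x \<le> \<gamma> * a" "a < b" for a b
  proof -
    have "ln b - ln a = ln (b / a)" using that by (simp add: ln_div)
    also have "\<dots> < b / a - 1" using that ln_less_self ln_add_one_self_less_self[of "b / a - 1"] by auto
    also have "\<dots> = (b - a) / a" using that by (simp add: field_simps)
    finally have "x * (ln b - ln a) < x * ((b - a) / a)" using x by (rule mult_strict_left_mono)
    also have "\<dots> = x / a * (b - a)" by simp
    also have "\<dots> \<le> \<gamma> * (b - a)" using that by (intro mult_right_mono) (auto simp: field_simps)
    finally show ?thesis by (simp add: f_def algebra_simps)
  qed
  show ?thesis
  proof (rule ex1I[of _ v])
    show "0 < v \<and> v \<le> x \<and> x \<le> \<gamma> * v \<and> y = (ln v + \<gamma>) * x - v * \<gamma>"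
      using v gamma_gt_1 less_le_trans[OF xg(1) v(1)] by (auto simp: f_def field_simps)
    then have v': "0 < v" "x \<le> \<gamma> * v" by auto
    fix u assume u: "0 < u \<and> u \<le> x \<and> x \<le> \<gamma> * u \<and> y = (ln u + \<gamma>) * x - u * \<gamma>"
    then have "f u = f v" using v by (simp add: f_def)
    then show "u = v" using strict[of u v] strict[of v u] u v' by (cases u v rule: linorder_cases) auto
  qed
qed

end

section \<open>From extremal weights to the Bellman function\<close>

lemma admissible_cong:
  assumes "\<And>t. t \<in> {0..1} \<Longrightarrow> w t = w' t"
  shows "admissible Q x y w \<longleftrightarrow> admissible Q x y w'"
proof -
  have avg_eq: "avg a b f = avg a b g" if "\<And>t. t \<in> {a..b} \<Longrightarrow> f t = g t" for a b f g
    unfolding avg_def using that set_lebesgue_integral_cong[of "{a..b}" lborel f g] by simp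
  have int_eq: "set_integrable lborel {0..1} f \<longleftrightarrow> set_integrable lborel {0..1} g"
    if "\<And>t. t \<in> {0..1} \<Longrightarrow> f t = g t" for f g :: "real \<Rightarrow> real"
    using that by (intro set_integrable_cong) auto
  have "avg a b (\<lambda>t. w t / avg a b w * ln (w t / avg a b w)) =
      avg a b (\<lambda>t. w' t / avg a b w' * ln (w' t / avg a b w'))" if "0 \<le> a" "b \<le> 1" for a b
  proof -
    have "avg a b w = avg a b w'" using assms that by (intro avg_eq) auto
    then show ?thesis using assms that by (intro avg_eq) auto
  qed
  then have "rh1 w = rh1 w'" unfolding rh1_def by (metis (no_types, lifting))
  moreover have "avg 0 1 w = avg 0 1 w'" "avg 0 1 (\<lambda>t. w t * ln (w t)) = avg 0 1 (\<lambda>t. w' t * ln (w' t))"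
    using assms by (auto intro!: avg_eq)
  moreover have "set_integrable lborel {0..1} w \<longleftrightarrow> set_integrable lborel {0..1} w'"
    "set_integrable lborel {0..1} (\<lambda>t. w t * ln (w t)) \<longleftrightarrow> set_integrable lborel {0..1} (\<lambda>t. w' t * ln (w' t))"
    using assms by (auto intro!: int_eq)
  moreover have "(\<lambda>t. t \<in> {0..1} \<longrightarrow> 0 < w t) = (\<lambda>t. t \<in> {0..1} \<longrightarrow> 0 < w' t)"
    using assms by auto
  ultimately show ?thesis by (simp only: admissible_def weight01_def)
qed

lemma pow_avg_cong:
  assumes "\<And>t. t \<in> {0..1} \<Longrightarrow> w t = w' t"
  shows "pow_avg \<epsilon> w = pow_avg \<epsilon> w'"
  unfolding pow_avg_def using assms
  by (intro arg_cong[of _ _ enn2ereal] nn_integral_cong) (auto split: split_indicator)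

text \<open>The intermediate value theorem yields a root above 1, and \<open>\<gamma>\<close> is at
  least as large.\<close>

lemma largest_root_gt_1:
  fixes Q \<gamma> :: real
  assumes "0 < Q" and largest: "\<forall>g>0. g - ln g = Q + 1 \<longrightarrow> g \<le> \<gamma>"
  shows "1 < \<gamma>"
proof -
  \<comment> \<open>Chosen so that \<open>s\<^sup>2\<close> bounds the root:
    \<open>s\<^sup>2 = 1 + 2 * sqrt Q + Q\<close>, while
    \<open>ln (s\<^sup>2) = 2 * ln s \<le> 2 * sqrt Q\<close>.\<close>
  define s where "s = 1 + sqrt Q"
  have s: "1 < s" using assms by (simp add: s_def)
  have "s\<^sup>2 = 1 + 2 * sqrt Q + Q" using assms by (simp add: s_def power2_sum)
  moreover have "ln s \<le> s - 1" using s by (intro ln_le_minus_one) simp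
  then have "ln (s\<^sup>2) \<le> 2 * sqrt Q"
    using s by (simp add: ln_realpow s_def)
  ultimately have "Q + 1 \<le> s\<^sup>2 - ln (s\<^sup>2)" by simp
  moreover have "continuous_on {1..s\<^sup>2} (\<lambda>g. g - ln g)" by (auto intro!: continuous_intros)
  moreover have "1 \<le> s\<^sup>2" using s by simp
  ultimately obtain g where g: "1 \<le> g" "g - ln g = Q + 1"
    using IVT'[of "\<lambda>g. g - ln g" 1 "Q + 1" "s\<^sup>2"] assms(1) by auto
  then have "g \<noteq> 1" using assms(1) by auto
  moreover have "g \<le> \<gamma>" using g largest by auto
  ultimately show ?thesis using g(1) by simp
qed

theorem theorem5:
  fixes Q \<epsilon> \<gamma> x y :: real
  assumes Q_pos: "0 < Q"
    and gamma_pos: "0 < \<gamma>"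
    and gamma_root: "\<gamma> - ln \<gamma> = Q + 1"
    and gamma_largest: "\<forall>g>0. g - ln g = Q + 1 \<longrightarrow> g \<le> \<gamma>"
    and eps_pos: "0 < \<epsilon>"
    and eps_bound: "\<epsilon> < 1 / (\<gamma> - 1)"
    and x_pos: "0 < x"
    and lower: "x * ln x \<le> y"
    and upper: "y \<le> x * ln x + Q * x"
  shows
    "(\<exists>!v. 0 < v \<and> v \<le> x \<and> x \<le> \<gamma> * v \<and> y = (ln v + \<gamma>) * x - v * \<gamma>)
     \<and> (\<forall>v. 0 < v \<and> v \<le> x \<and> x \<le> \<gamma> * v \<and> y = (ln v + \<gamma>) * x - v * \<gamma> \<longrightarrow>
          Bell \<epsilon> Q x y =
            ereal (v powr \<epsilon> / (1 + \<epsilon> - \<gamma> * \<epsilon>) * (x * (1 + \<epsilon>) - \<epsilon> * \<gamma> * v)))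
     \<and> (y = x * ln x + Q * x \<longrightarrow>
          admissible Q x y (\<lambda>t. x / \<gamma> * t powr ((1 - \<gamma>) / \<gamma>)) \<and>
          pow_avg \<epsilon> (\<lambda>t. x / \<gamma> * t powr ((1 - \<gamma>) / \<gamma>)) = Bell \<epsilon> Q x y)
     \<and> (\<exists>w C a. 0 < C \<and> 0 \<le> a \<and> a \<le> 1 \<and>
          (\<forall>t\<in>{0<..1}. w t = (if a = 0 then C
                                 else if t \<le> a then C * t powr ((1 - \<gamma>) / \<gamma>)
                                 else C * a powr ((1 - \<gamma>) / \<gamma>))) \<and>
          admissible Q x y w \<and> pow_avg \<epsilon> w = Bell \<epsilon> Q x y)"
proof -
  have g1: "1 < \<gamma>" by (rule largest_root_gt_1[OF Q_pos gamma_largest])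
  interpret rh1_params Q \<epsilon> \<gamma>
    using gamma_root g1 eps_pos eps_bound by unfold_locales (simp_all add: field_simps)
  let ?P = "\<lambda>v. 0 < v \<and> v \<le> x \<and> x \<le> \<gamma> * v \<and> y = (ln v + \<gamma>) * x - v * \<gamma>"
  have ex1: "\<exists>!v. ?P v" by (rule ex1_tangent_parameter[OF x_pos lower upper])
  have Bell: "Bell \<epsilon> Q x y = ereal (bellman_value x v)" if "?P v" for v
  proof (rule antisym)
    show "Bell \<epsilon> Q x y \<le> ereal (bellman_value x v)"
      unfolding Bell_def using that pow_avg_le_bellman_value by (intro Sup_least) auto
    show "ereal (bellman_value x v) \<le> Bell \<epsilon> Q x y"
      unfolding Bell_def using that extremal_averages(4)[of v x y]
      by (subst extremal_averages(5)[of v x y, symmetric]) (auto intro!: Sup_upper)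
  qed
  from ex1 obtain v where v: "?P v" by blast
  note ext = extremal_averages[of v x y]
  define a C where "a = (x / v - 1) / (\<gamma> - 1)" and "C = (if a = 0 then v else v * a powr (- \<beta>))"
  have C: "0 < C" "0 \<le> a" "a \<le> 1" "admissible Q x y (extremal C a)"
    "pow_avg \<epsilon> (extremal C a) = Bell \<epsilon> Q x y"
    unfolding a_def C_def using ext Bell[OF v] v by auto
  have top: "admissible Q x y (\<lambda>t. x / \<gamma> * t powr \<beta>) \<and>
      pow_avg \<epsilon> (\<lambda>t. x / \<gamma> * t powr \<beta>) = Bell \<epsilon> Q x y"
    if y: "y = x * ln x + Q * x"
  proof -
    have "(ln (x / \<gamma>) + \<gamma>) * x - x / \<gamma> * \<gamma> = x * (ln x + (\<gamma> - ln \<gamma>) - 1)"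
      using x_pos g1 by (simp add: ln_div algebra_simps)
    \<comment> \<open>On the upper boundary the tangency parameter is \<open>x / \<gamma>\<close>,
      which forces \<open>a = 1\<close>: the plateau disappears.\<close>
    then have "?P (x / \<gamma>)"
      using x_pos g1 y unfolding gamma_root by (auto simp: field_simps)
    with ex1 v have "v = x / \<gamma>" by blast
    then have "a = 1" "C = x / \<gamma>" using x_pos g1 by (auto simp: a_def C_def)
    then have "extremal C a t = x / \<gamma> * t powr \<beta>" if "t \<in> {0..1}" for t
      using that by (simp add: extremal_def)
    \<comment> \<open>The pure power and \<open>extremal C 1\<close> agree on the unit interval but
      not beyond it, hence the congruence lemmas.\<close>
    then show ?thesis
      using C(4,5) admissible_cong[of "extremal C a" "\<lambda>t. x / \<gamma> * t powr \<beta>"]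
        pow_avg_cong[of "extremal C a" "\<lambda>t. x / \<gamma> * t powr \<beta>"] by simp
  qed
  show ?thesis
  proof (intro conjI)
    show "\<exists>!v. ?P v" by (rule ex1)
    show "\<forall>v. ?P v \<longrightarrow> Bell \<epsilon> Q x y =
        ereal (v powr \<epsilon> / (1 + \<epsilon> - \<gamma> * \<epsilon>) * (x * (1 + \<epsilon>) - \<epsilon> * \<gamma> * v))"
      using Bell by (simp add: bellman_value_def)
    show "y = x * ln x + Q * x \<longrightarrow> admissible Q x y (\<lambda>t. x / \<gamma> * t powr \<beta>) \<and>
        pow_avg \<epsilon> (\<lambda>t. x / \<gamma> * t powr \<beta>) = Bell \<epsilon> Q x y"
      using top by blast
    show "\<exists>w C a. 0 < C \<and> 0 \<le> a \<and> a \<le> 1 \<and>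
          (\<forall>t\<in>{0<..1}. w t = (if a = 0 then C else if t \<le> a then C * t powr \<beta> else C * a powr \<beta>)) \<and>
          admissible Q x y w \<and> pow_avg \<epsilon> w = Bell \<epsilon> Q x y"
      using C by (intro exI[of _ "extremal C a"] exI[of _ C] exI[of _ a]) (auto simp: extremal_def)
  qed
qed

end
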